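(* Let $\{\mathbb{Q}^{(n)}\}_{n\in\mathbb{N}}$ be a sequence in $\mathcal{Q}_{\ll}(\mathbb{P})$ and let $\mathbb{Q}\in\mathcal{Q}_{\ll}(\mathbb{P})$ be such that $D_T^{(n)}:=\left.\frac{d\mathbb{Q}^{(n)}}{d\mathbb{P}}\right|_{\mathcal{F}_T}$ converges to $D_T:=\left.\frac{d\mathbb{Q}}{d\mathbb{P}}\right|_{\mathcal{F}_T}$ in $L^1(\mathbb{P})$. For the corresponding density processes $D_t^{(n)}:=\mathbb{E}_{\mathbb{P}}[D_T^{(n)}\,|\,\mathcal{F}_t]$ and $D_t:=\mathbb{E}_{\mathbb{P}}[D_T\,|\,\mathcal{F}_t]$, $t\in[0,T]$, we have $$\left[D^{(n)}-D\right]_T\longrightarrow 0\quad\text{in } \mathbb{P}\text{-probability as } n\to\infty.$$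
   Context: $(\Omega,\mathcal{F},\mathbb{P})$ is a probability space supporting a Lévy process $L=\{L_t\}_{t\ge 0}$ (adapted, càdlàg, independent stationary increments, $L_0=0$), with filtration $\mathcal{F}_t:=\sigma\{L_s:s\le t\}\vee\mathcal{N}$, where $\mathcal{N}$ is the $\sigma$-algebra generated by all $\mathbb{P}$-null sets. $T>0$ is fixed, time is restricted to $[0,T]$, and $\mathcal{F}=\mathcal{F}_T$. $\mathcal{Q}_{\ll}(\mathbb{P})$ is the set of probability measures on $(\Omega,\mathcal{F})$ absolutely continuous with respect to $\mathbb{P}$. Density processes are taken in their càdlàg versions, and $[\,\cdot\,]$ denotes quadratic variation. *)

theory Defs
  imports "HOL-Probability.Probability"
begin

definition cadlag_on :: "real \<Rightarrow> (real \<Rightarrow> 'b::topological_space) \<Rightarrow> bool" where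
  "cadlag_on T f \<longleftrightarrow>
     (\<forall>t\<in>{0..<T}. (f \<longlongrightarrow> f t) (at_right t)) \<and>
     (\<forall>t\<in>{0<..T}. \<exists>l. (f \<longlongrightarrow> l) (at_left t))"

text \<open>Levy processes with time restricted to \<open>[0, T]\<close>; the values of \<open>L t\<close> for \<open>t\<close>
  outside this interval are irrelevant.\<close>

definition levy_process_on ::
    "'a measure \<Rightarrow> real \<Rightarrow> (real \<Rightarrow> 'a \<Rightarrow> 'b::euclidean_space) \<Rightarrow> bool" where
  "levy_process_on M T L \<longleftrightarrow>
     (\<forall>t\<in>{0..T}. L t \<in> borel_measurable M) \<and>
     (AE \<omega> in M. L 0 \<omega> = 0) \<and>
     (AE \<omega> in M. cadlag_on T (\<lambda>t. L t \<omega>)) \<and>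
     (\<forall>n (p :: nat \<Rightarrow> real). 0 \<le> p 0 \<and> (\<forall>i<n. p i < p (Suc i)) \<and> p n \<le> T \<longrightarrow>
        prob_space.indep_vars M (\<lambda>_. borel) (\<lambda>i \<omega>. L (p (Suc i)) \<omega> - L (p i) \<omega>) {..<n}) \<and>
     (\<forall>s h. 0 \<le> s \<and> 0 \<le> h \<and> s + h \<le> T \<longrightarrow>
        distr M borel (\<lambda>\<omega>. L (s + h) \<omega> - L s \<omega>) = distr M borel (\<lambda>\<omega>. L h \<omega> - L 0 \<omega>))"

text \<open>The natural filtration enlarged by the null sets of \<open>M\<close>. Only the sigma-algebra of
  this measure is meaningful.\<close>

definition augmented_filtration ::
    "'a measure \<Rightarrow> (real \<Rightarrow> 'a \<Rightarrow> 'b::topological_space) \<Rightarrow> real \<Rightarrow> 'a measure" where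
  "augmented_filtration M L t =
     sigma (space M) ({L s -` A \<inter> space M | s A. 0 \<le> s \<and> s \<le> t \<and> A \<in> sets borel} \<union> null_sets M)"

definition ac_prob_measures :: "'a measure \<Rightarrow> 'a measure set" where
  "ac_prob_measures M = {Q. prob_space Q \<and> sets Q = sets M \<and> absolutely_continuous M Q}"

definition prob_density :: "'a measure \<Rightarrow> 'a measure \<Rightarrow> 'a \<Rightarrow> real" where
  "prob_density M Q \<omega> = enn2real (RN_deriv M Q \<omega>)"

text \<open>\<open>D\<close> is a cadlag version on \<open>[0, T]\<close> of the density process of \<open>Q\<close> with respect to
  \<open>M\<close>, for the filtration \<open>F\<close>.\<close>

definition density_process ::
    "'a measure \<Rightarrow> (real \<Rightarrow> 'a measure) \<Rightarrow> real \<Rightarrow> 'a measure \<Rightarrow> (real \<Rightarrow> 'a \<Rightarrow> real) \<Rightarrow> bool" where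
  "density_process M F T Q D \<longleftrightarrow>
     (\<forall>t\<in>{0..T}. D t \<in> borel_measurable (F t) \<and>
        (AE \<omega> in M. D t \<omega> = real_cond_exp M (F t) (prob_density M Q) \<omega>)) \<and>
     (AE \<omega> in M. cadlag_on T (\<lambda>t. D t \<omega>))"

definition tendsto_in_prob ::
    "'a measure \<Rightarrow> (nat \<Rightarrow> 'a \<Rightarrow> real) \<Rightarrow> ('a \<Rightarrow> real) \<Rightarrow> bool" where
  "tendsto_in_prob M X Y \<longleftrightarrow>
     (\<forall>\<epsilon>>0. (\<lambda>n. measure M {\<omega>\<in>space M. \<bar>X n \<omega> - Y \<omega>\<bar> > \<epsilon>}) \<longlonglongrightarrow> 0)"

text \<open>A partition \<open>0 = p 0 < \<dots> < p N = t\<close> is given by \<open>p\<close> and the number \<open>N\<close> of its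
  intervals.\<close>

definition is_partition :: "real \<Rightarrow> nat \<Rightarrow> (nat \<Rightarrow> real) \<Rightarrow> bool" where
  "is_partition t N p \<longleftrightarrow> p 0 = 0 \<and> p N = t \<and> (\<forall>i<N. p i < p (Suc i))"

text \<open>\<open>V\<close> is (a version of) the quadratic variation \<open>[X]\<^sub>t\<close>: the limit in probability of the
  sums of squared increments along every sequence of deterministic partitions of \<open>[0, t]\<close>
  with mesh tending to 0. The convention is \<open>[X]\<^sub>0 = 0\<close>, i.e. no summand \<open>X\<^sub>0\<^sup>2\<close>.\<close>

definition has_quadratic_variation ::
    "'a measure \<Rightarrow> (real \<Rightarrow> 'a \<Rightarrow> real) \<Rightarrow> real \<Rightarrow> ('a \<Rightarrow> real) \<Rightarrow> bool" where
  "has_quadratic_variation M X t V \<longleftrightarrow>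
     V \<in> borel_measurable M \<and>
     (\<forall>(N :: nat \<Rightarrow> nat) (p :: nat \<Rightarrow> nat \<Rightarrow> real).
        (\<forall>k. is_partition t (N k) (p k)) \<and>
        (\<forall>\<delta>>0. \<forall>\<^sub>F k in sequentially. \<forall>i<N k. p k (Suc i) - p k i < \<delta>) \<longrightarrow>
        tendsto_in_prob M (\<lambda>k \<omega>. \<Sum>i<N k. (X (p k (Suc i)) \<omega> - X (p k i) \<omega>)\<^sup>2) V)"

text \<open>Such a \<open>V\<close> exists for every cadlag martingale (more generally, semimartingale) \<open>X\<close>
  and is unique up to null sets.\<close>

definition quadratic_variation ::
    "'a measure \<Rightarrow> (real \<Rightarrow> 'a \<Rightarrow> real) \<Rightarrow> real \<Rightarrow> 'a \<Rightarrow> real" where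
  "quadratic_variation M X t = (SOME V. has_quadratic_variation M X t V)"

end

theory Submission
  imports Defs
begin

text \<open>The proof rests on Burkholder's weak type \<open>(1, 1)\<close> inequalities for discrete martingales: both
  the square function and the transforms by multipliers bounded by 1 exceed \<open>l\<close> with probability at
  most \<open>2 * E \<bar>X\<^sub>n\<bar> / l\<close>. They follow from a special function of the martingale and its transform whose
  expectation decreases along the martingale.

  The square function estimate passes to the limit along partitions, so \<open>[X]\<^sub>T\<close> exceeds \<open>l\<close> with
  probability at most a constant times \<open>E \<bar>X\<^sub>T\<bar> / sqrt l\<close>. Applied to the difference of two density
  processes this gives the claim, once the quadratic variation of a cadlag martingale is known to exist.

  For the existence, let \<open>r\<close> refine \<open>p\<close>. The sums of squares along \<open>r\<close> and \<open>p\<close> differ by twice the sum of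
  \<open>(X - X') * dX\<close> along \<open>r\<close>, where \<open>X'\<close> is the value at the last point of \<open>p\<close>. Replace \<open>X'\<close> by a hysteresis
  \<open>A\<close>, which is also reset to the value of \<open>X\<close> whenever that has moved by more than \<open>\<epsilon>\<close>. Then
  \<open>(X - A) * dX\<close> sums to a transform by a multiplier bounded by \<open>\<epsilon>\<close>, which is small in probability by the
  weak type inequality, without any integrability beyond \<open>L\<^sup>1\<close>, whereas the sum of \<open>(A - X') * dX\<close> tends
  to 0 along every cadlag path as the mesh of \<open>p\<close> tends to 0.\<close>

section \<open>Weak type inequalities for discrete martingales\<close>

text \<open>Burkholder's special function for the weak type \<open>(1, 1)\<close> inequality. The second argument stands
  for the square of the transform, so that transforms and square functions, whose square grows by
  \<open>2 * c * h + k\<^sup>2\<close> with \<open>c\<^sup>2 \<le> w\<close> and \<open>k\<^sup>2 \<le> h\<^sup>2\<close> when the martingale grows by \<open>h\<close>, are treated at once.\<close>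

definition bell :: "real \<Rightarrow> real \<Rightarrow> real" where
  "bell x w = (if \<bar>x\<bar> + sqrt w < 1 then w - x\<^sup>2 else 1 - 2 * \<bar>x\<bar>)"

text \<open>The derivative at \<open>h = 0\<close> of \<open>bell\<close> along the move from
  \<open>(x, w)\<close> to \<open>(x + h, w + 2 * c * h)\<close>, taken region by region. At the
  kink \<open>x = 0\<close> of the outer formula, \<open>sgn 0 = 0\<close> selects one of its
  supergradients.\<close>

definition bell_slope :: "real \<Rightarrow> real \<Rightarrow> real \<Rightarrow> real" where
  "bell_slope x w c = (if \<bar>x\<bar> + sqrt w < 1 then 2 * c - 2 * x else - 2 * sgn x)"

text \<open>A jump from the inner region past 1. With \<open>s = sqrt w\<close>, both
  \<open>h \<ge> 1 - x\<close> and \<open>1 - x + c \<ge> 1 - x - s\<close>; inserting the product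
  of these bounds reduces the claim to \<open>(1 - x - s)\<^sup>2 \<ge> 0\<close>.\<close>

lemma bell_upper_aux:
  fixes x w c h :: real
  assumes "0 \<le> w" "c\<^sup>2 \<le> w" "x + sqrt w < 1" "x + h > 1"
  shows "1 - 2 * (x + h) \<le> w - x\<^sup>2 + (2 * c - 2 * x) * h"
proof -
  define s where "s = sqrt w"
  have s: "s \<ge> 0" "w = s\<^sup>2" "x + s < 1" using assms by (auto simp: s_def)
  have "\<bar>c\<bar> \<le> s" using real_sqrt_le_mono[OF assms(2)] by (simp add: s_def)
  hence c: "1 - x - s \<le> 1 - x + c" by linarith
  have "(1 - x) * (1 - x - s) \<le> h * (1 - x + c)"
    by (rule mult_mono) (use assms s c in auto)
  moreover have "(1 - x - s)\<^sup>2 \<ge> 0" by simp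
  ultimately show ?thesis unfolding s(2) by (simp add: power2_eq_square algebra_simps)
qed

text \<open>A tangent inequality for moves of any size. From the inner region,
  \<open>w - x\<^sup>2\<close> changes by the linear term plus
  \<open>k\<^sup>2 - h\<^sup>2 \<le> 0\<close>. If the move ends outside at \<open>z\<close> with
  \<open>\<bar>z\<bar> \<le> 1\<close>, then
  \<open>1 - 2 * \<bar>z\<bar> \<le> w' - z\<^sup>2\<close>, so the same bound serves;
  \<open>\<bar>z\<bar> > 1\<close> calls for \<open>bell_upper_aux\<close>. From outside, concavity
  of \<open>1 - 2 * \<bar>x\<bar>\<close> decides.\<close>

lemma bell_step:
  fixes x w c h k w' :: real
  assumes w: "0 \<le> w" "c\<^sup>2 \<le> w" and k: "k\<^sup>2 \<le> h\<^sup>2" and w': "w' = w + 2 * c * h + k\<^sup>2" "0 \<le> w'"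
  shows "bell (x + h) w' \<le> bell x w + bell_slope x w c * h"
proof (cases "\<bar>x\<bar> + sqrt w < 1")
  case inside: True
  have quad: "w' - (x + h)\<^sup>2 \<le> w - x\<^sup>2 + (2 * c - 2 * x) * h"
    using k w' by (simp add: power2_eq_square algebra_simps)
  show ?thesis
  proof (cases "\<bar>x + h\<bar> + sqrt w' < 1")
    case True
    then show ?thesis using quad inside by (simp add: bell_def bell_slope_def)
  next
    case False
    have "1 - 2 * \<bar>x + h\<bar> \<le> w - x\<^sup>2 + (2 * c - 2 * x) * h"
    proof (cases "\<bar>x + h\<bar> \<le> 1")
      case True
      have "(1 - \<bar>x + h\<bar>)\<^sup>2 \<le> (sqrt w')\<^sup>2"
        by (rule power_mono) (use False True in auto)
      hence "1 - 2 * \<bar>x + h\<bar> \<le> w' - (x + h)\<^sup>2"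
        using w' by (simp add: power2_eq_square algebra_simps abs_mult_self_eq)
      with quad show ?thesis by linarith
    next
      case far: False
      show ?thesis
      proof (cases "x + h > 1")
        case True
        then show ?thesis using bell_upper_aux[of w c x h] w inside by auto
      next
        case False
        hence "(-x) + (-h) > 1" using far by linarith
        then show ?thesis using bell_upper_aux[of w "-c" "-x" "-h"] w inside
          by (auto simp: algebra_simps)
      qed
    qed
    then show ?thesis using False inside by (simp add: bell_def bell_slope_def)
  qed
next
  case outside: False
  \<comment> \<open>In the inner region \<open>w' \<le> (1 - \<bar>z\<bar>)\<^sup>2\<close>, so
    \<open>bell\<close> lies below \<open>1 - 2 * \<bar>z\<bar>\<close> everywhere and hence below
    three affine functions, one of which is the tangent chosen by \<open>bell_slope\<close> at
    \<open>x\<close>.\<close>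
  have le: "bell (x + h) w' \<le> 1" "bell (x + h) w' \<le> 1 - 2 * (x + h)" "bell (x + h) w' \<le> 1 + 2 * (x + h)"
  proof -
    define z where "z = x + h"
    have "w' \<le> (1 - \<bar>z\<bar>)\<^sup>2" if "\<bar>z\<bar> + sqrt w' < 1"
    proof -
      have "(sqrt w')\<^sup>2 \<le> (1 - \<bar>z\<bar>)\<^sup>2" by (rule power_mono) (use that w' in auto)
      thus ?thesis using w' by simp
    qed
    hence "bell z w' \<le> 1 - 2 * \<bar>z\<bar>"
      by (auto simp: bell_def power2_eq_square algebra_simps abs_mult_self_eq)
    hence "bell z w' \<le> 1" "bell z w' \<le> 1 - 2 * z" "bell z w' \<le> 1 + 2 * z"
      using abs_ge_self[of z] abs_ge_minus_self[of z] by auto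
    thus "bell (x + h) w' \<le> 1" "bell (x + h) w' \<le> 1 - 2 * (x + h)" "bell (x + h) w' \<le> 1 + 2 * (x + h)"
      by (simp_all add: z_def)
  qed
  have "bell x w + bell_slope x w c * h = 1 - 2 * \<bar>x\<bar> - 2 * sgn x * h"
    using outside by (simp add: bell_def bell_slope_def)
  then show ?thesis using le by (cases "x = 0"; cases "x > 0") (auto simp: sgn_if)
qed

text \<open>In the inner region \<open>w < 1\<close> and
  \<open>x\<^sup>2 \<le> \<bar>x\<bar>\<close>; outside, the bound is immediate.\<close>

lemma bell_lower: "0 \<le> w \<Longrightarrow> (if w \<ge> 1 then 1 else 0) - 2 * \<bar>x\<bar> \<le> bell x w"
proof -
  assume w: "0 \<le> w"
  have "x\<^sup>2 \<le> \<bar>x\<bar>" if "\<bar>x\<bar> < 1"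
    using mult_left_mono[of "\<bar>x\<bar>" 1 "\<bar>x\<bar>"] that by (simp add: power2_eq_square abs_mult_self_eq)
  moreover have "\<not> w \<ge> 1" if "\<bar>x\<bar> + sqrt w < 1"
    using that real_sqrt_ge_one[of w] by linarith
  moreover have "\<bar>x\<bar> < 1" if "\<bar>x\<bar> + sqrt w < 1"
    using that w real_sqrt_ge_zero[of w] by linarith
  ultimately show ?thesis using w by (auto simp: bell_def)
qed

text \<open>Here \<open>sqrt w \<le> \<bar>x\<bar>\<close>, so a point of the outer region satisfies
  \<open>2 * \<bar>x\<bar> \<ge> 1\<close>.\<close>

lemma bell_initial:
  assumes "w \<le> x\<^sup>2" shows "bell x w \<le> 0"
proof -
  have "sqrt w \<le> \<bar>x\<bar>" using real_sqrt_le_mono[OF assms] by simp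
  thus ?thesis using assms by (auto simp: bell_def)
qed

lemma bell_bound: "0 \<le> w \<Longrightarrow> \<bar>bell x w\<bar> \<le> 1 + 2 * \<bar>x\<bar>"
proof -
  assume w: "0 \<le> w"
  have "w < 1" "x\<^sup>2 < 1" if "\<bar>x\<bar> + sqrt w < 1"
  proof -
    have "sqrt w < 1" "\<bar>x\<bar> < 1" using that w real_sqrt_ge_zero[of w] by linarith+
    thus "w < 1" "x\<^sup>2 < 1" by (auto simp: abs_square_less_1)
  qed
  thus ?thesis using w by (auto simp: bell_def abs_le_iff) (smt (verit) zero_le_power2)+
qed

text \<open>Makes the slope an admissible multiplier in the martingale property, so that
  integrability of the martingale suffices.\<close>

lemma bell_slope_bound:
  assumes "0 \<le> w" "c\<^sup>2 \<le> w" shows "\<bar>bell_slope x w c\<bar> \<le> 4"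
proof -
  have "\<bar>c\<bar> \<le> sqrt w" using real_sqrt_le_mono[OF assms(2)] by simp
  hence "\<bar>2 * c - 2 * x\<bar> \<le> 4" if "\<bar>x\<bar> + sqrt w < 1" using that by linarith
  thus ?thesis by (auto simp: bell_slope_def sgn_if)
qed

lemma bell_measurable:
  assumes [measurable]: "f \<in> borel_measurable N" "g \<in> borel_measurable N"
  shows "(\<lambda>\<omega>. bell (f \<omega>) (g \<omega>)) \<in> borel_measurable N"
  unfolding bell_def by measurable

lemma bell_slope_measurable:
  assumes [measurable]: "f \<in> borel_measurable N" "g \<in> borel_measurable N" "h \<in> borel_measurable N"
  shows "(\<lambda>\<omega>. bell_slope (f \<omega>) (g \<omega>) (h \<omega>)) \<in> borel_measurable N"
  unfolding bell_slope_def sgn_if by measurable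

section \<open>Discrete martingales, their transforms and square functions\<close>

text \<open>The martingale property is stated as orthogonality of increments to bounded multipliers
  measurable at the earlier time. This is the form in which it is used, and it avoids conditional
  expectations.\<close>

locale finite_martingale = prob_space M for M :: "'a measure" +
  fixes F :: "nat \<Rightarrow> 'a measure" and X :: "nat \<Rightarrow> 'a \<Rightarrow> real" and n :: nat
  assumes subalg: "j \<le> n \<Longrightarrow> subalgebra M (F j)"
    and filt: "j < n \<Longrightarrow> subalgebra (F (Suc j)) (F j)"
    and adapted: "j \<le> n \<Longrightarrow> X j \<in> borel_measurable (F j)"
    and integ: "j \<le> n \<Longrightarrow> integrable M (X j)"
    and orth: "\<lbrakk>j < n; g \<in> borel_measurable (F j); \<And>\<omega>. \<bar>g \<omega>\<bar> \<le> K\<rbrakk>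
      \<Longrightarrow> (\<integral>\<omega>. g \<omega> * (X (Suc j) \<omega> - X j \<omega>) \<partial>M) = 0"
begin

text \<open>The means of \<open>bell (a * X j) (W j)\<close> decrease in \<open>j\<close> by \<open>bell_step\<close> and start nonpositive, and
  \<open>bell\<close> dominates the function \<open>indicator {1..} w - 2 * \<bar>x\<bar>\<close>.\<close>

lemma weak_type:
  fixes W c k :: "nat \<Rightarrow> 'a \<Rightarrow> real"
  assumes W: "\<And>j. j \<le> n \<Longrightarrow> W j \<in> borel_measurable (F j)"
    and c: "\<And>j. j < n \<Longrightarrow> c j \<in> borel_measurable (F j)"
    and W0: "\<And>\<omega>. W 0 \<omega> \<le> (a * X 0 \<omega>)\<^sup>2"
    and pos: "\<And>j \<omega>. 0 \<le> W j \<omega>"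
    and cW: "\<And>j \<omega>. j < n \<Longrightarrow> (c j \<omega>)\<^sup>2 \<le> W j \<omega>"
    and k: "\<And>j \<omega>. j < n \<Longrightarrow> (k j \<omega>)\<^sup>2 \<le> (a * (X (Suc j) \<omega> - X j \<omega>))\<^sup>2"
    and step: "\<And>j \<omega>. j < n \<Longrightarrow>
      W (Suc j) \<omega> = W j \<omega> + 2 * c j \<omega> * (a * (X (Suc j) \<omega> - X j \<omega>)) + (k j \<omega>)\<^sup>2"
  shows "measure M {\<omega> \<in> space M. 1 \<le> W n \<omega>} \<le> 2 * \<bar>a\<bar> * (\<integral>\<omega>. \<bar>X n \<omega>\<bar> \<partial>M)"
proof -
  \<comment> \<open>The factor \<open>a\<close> rescales the martingale, so that the level to be
    exceeded is always 1.\<close>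
  define b where "b j \<omega> = bell (a * X j \<omega>) (W j \<omega>)" for j \<omega>
  have XM[measurable]: "X j \<in> borel_measurable M" if "j \<le> n" for j
    using measurable_from_subalg[OF subalg adapted] that by auto
  have WM[measurable]: "W j \<in> borel_measurable M" if "j \<le> n" for j
    using measurable_from_subalg[OF subalg W] that by auto
  have bi: "integrable M (b j)" if "j \<le> n" for j
  proof (rule Bochner_Integration.integrable_bound)
    show "integrable M (\<lambda>\<omega>. 1 + 2 * \<bar>a * X j \<omega>\<bar>)"
      using integ[OF that] by auto
    show "b j \<in> borel_measurable M"
      unfolding b_def by (rule bell_measurable) (use that in measurable)
    show "AE \<omega> in M. norm (b j \<omega>) \<le> norm (1 + 2 * \<bar>a * X j \<omega>\<bar>)"
    proof (intro AE_I2)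
      fix \<omega> show "norm (b j \<omega>) \<le> norm (1 + 2 * \<bar>a * X j \<omega>\<bar>)"
        using bell_bound[OF pos, of "a * X j \<omega>" j \<omega>] by (simp add: b_def)
    qed
  qed
  have "(\<integral>\<omega>. b j \<omega> \<partial>M) \<le> 0" if "j \<le> n" for j
    using that
  proof (induction j)
    case 0
    have "0 \<le> (\<integral>\<omega>. - b 0 \<omega> \<partial>M)"
      unfolding b_def using bell_initial[OF W0] by (intro Bochner_Integration.integral_nonneg) auto
    then show ?case by simp
  next
    case (Suc j)
    define g where "g \<omega> = bell_slope (a * X j \<omega>) (W j \<omega>) (c j \<omega>)" for \<omega>
    have gF: "g \<in> borel_measurable (F j)"
      unfolding g_def by (rule bell_slope_measurable) (use Suc adapted[of j] W[of j] c[of j] in auto)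
    hence gM[measurable]: "g \<in> borel_measurable M"
      using measurable_from_subalg[OF subalg[of j]] Suc by auto
    have Gb: "\<bar>g \<omega>\<bar> \<le> 4" for \<omega>
      unfolding g_def using bell_slope_bound pos cW Suc by auto
    have gi: "integrable M (\<lambda>\<omega>. g \<omega> * (X (Suc j) \<omega> - X j \<omega>))"
    proof (rule Bochner_Integration.integrable_bound)
      show "integrable M (\<lambda>\<omega>. 4 * (X (Suc j) \<omega> - X j \<omega>))"
        using integ Suc by auto
      show "(\<lambda>\<omega>. g \<omega> * (X (Suc j) \<omega> - X j \<omega>)) \<in> borel_measurable M"
        using XM[of j] XM[of "Suc j"] Suc by auto
      show "AE x in M. norm (g x * (X (Suc j) x - X j x)) \<le> norm (4 * (X (Suc j) x - X j x))"
        unfolding real_norm_def abs_mult using Gb by (intro AE_I2 mult_right_mono) auto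
    qed
    \<comment> \<open>The term linear in the increment will have mean zero by \<open>orth\<close>,
      since \<open>g\<close> is bounded and \<open>F j\<close>-measurable.\<close>
    have "(\<integral>\<omega>. b (Suc j) \<omega> \<partial>M) \<le> (\<integral>\<omega>. b j \<omega> + a * (g \<omega> * (X (Suc j) \<omega> - X j \<omega>)) \<partial>M)"
    proof (rule integral_mono)
      fix \<omega>
      have "bell (a * X j \<omega> + a * (X (Suc j) \<omega> - X j \<omega>)) (W (Suc j) \<omega>) \<le>
        bell (a * X j \<omega>) (W j \<omega>) + g \<omega> * (a * (X (Suc j) \<omega> - X j \<omega>))"
        unfolding g_def by (rule bell_step[OF pos cW[of j] k[of j] step[of j] pos]) (use Suc in auto)
      thus "b (Suc j) \<omega> \<le> b j \<omega> + a * (g \<omega> * (X (Suc j) \<omega> - X j \<omega>))"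
        by (simp add: b_def algebra_simps)
    qed (use Suc bi gi in auto)
    also have "\<dots> = (\<integral>\<omega>. b j \<omega> \<partial>M)"
      using Suc bi gi orth[OF _ gF Gb] by simp
    finally show ?case using Suc by simp
  qed
  hence "(\<integral>\<omega>. b n \<omega> \<partial>M) \<le> 0" by simp
  moreover have "(\<integral>\<omega>. indicator {\<omega> \<in> space M. 1 \<le> W n \<omega>} \<omega> - 2 * \<bar>a\<bar> * \<bar>X n \<omega>\<bar> \<partial>M) \<le> (\<integral>\<omega>. b n \<omega> \<partial>M)"
  proof (rule integral_mono)
    fix \<omega> assume "\<omega> \<in> space M"
    thus "indicator {\<omega> \<in> space M. 1 \<le> W n \<omega>} \<omega> - 2 * \<bar>a\<bar> * \<bar>X n \<omega>\<bar> \<le> b n \<omega>"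
      using bell_lower[OF pos, of n \<omega> "a * X n \<omega>"] by (auto simp: b_def indicator_def abs_mult)
  qed (use bi integ in \<open>auto simp: less_top[symmetric]\<close>)
  moreover have "(\<integral>\<omega>. indicator {\<omega> \<in> space M. 1 \<le> W n \<omega>} \<omega> - 2 * \<bar>a\<bar> * \<bar>X n \<omega>\<bar> \<partial>M) =
     measure M {\<omega> \<in> space M. 1 \<le> W n \<omega>} - 2 * \<bar>a\<bar> * (\<integral>\<omega>. \<bar>X n \<omega>\<bar> \<partial>M)"
    using integ by (subst Bochner_Integration.integral_diff) (auto simp: less_top[symmetric])
  ultimately show ?thesis by linarith
qed

lemma measurable_Suc: "j < n \<Longrightarrow> f \<in> borel_measurable (F j) \<Longrightarrow> f \<in> borel_measurable (F (Suc j))"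
  using measurable_from_subalg[OF filt] .

lemma increment_measurable:
  "j < n \<Longrightarrow> (\<lambda>\<omega>. X (Suc j) \<omega> - X j \<omega>) \<in> borel_measurable (F (Suc j))"
  using adapted[of "Suc j"] measurable_Suc[OF _ adapted[of j]] by auto

lemma transform_weak_type:
  assumes U: "\<And>j. j < n \<Longrightarrow> U j \<in> borel_measurable (F j)"
    and bd: "\<And>j \<omega>. j < n \<Longrightarrow> \<bar>U j \<omega>\<bar> \<le> \<epsilon>" and "\<epsilon> > 0" "l > 0"
  shows "measure M {\<omega> \<in> space M. \<bar>\<Sum>j<n. U j \<omega> * (X (Suc j) \<omega> - X j \<omega>)\<bar> \<ge> l}
    \<le> 2 * \<epsilon> / l * (\<integral>\<omega>. \<bar>X n \<omega>\<bar> \<partial>M)"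
proof -
  define Y where "Y m \<omega> = (\<Sum>j<m. U j \<omega> * (X (Suc j) \<omega> - X j \<omega>))" for m \<omega>
  have Y: "Y m \<in> borel_measurable (F m)" if "m \<le> n" for m
    using that
  proof (induction m)
    case 0
    then show ?case by (simp add: Y_def)
  next
    case (Suc m)
    have "Y m \<in> borel_measurable (F (Suc m))" "U m \<in> borel_measurable (F (Suc m))"
      using measurable_Suc[of m] Suc U[of m] by auto
    with increment_measurable[of m] show ?case using Suc(2) unfolding Y_def by auto
  qed
  have "measure M {\<omega> \<in> space M. 1 \<le> (Y n \<omega> / l)\<^sup>2} \<le> 2 * \<bar>\<epsilon> / l\<bar> * (\<integral>\<omega>. \<bar>X n \<omega>\<bar> \<partial>M)"
  \<comment> \<open>The square of \<open>Y / l\<close> grows by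
    \<open>2 * (Y / l) * (U * dX / l) + (U * dX / l)\<^sup>2\<close>. Pulling out the scaled
    increment \<open>\<epsilon> / l * dX\<close> forces this \<open>c\<close>, and
    \<open>\<bar>U\<bar> \<le> \<epsilon>\<close> gives the two conditions on \<open>c\<close> and
    \<open>k\<close>.\<close>
  proof (rule weak_type[where W = "\<lambda>m \<omega>. (Y m \<omega> / l)\<^sup>2" and c = "\<lambda>j \<omega>. Y j \<omega> * U j \<omega> / (l * \<epsilon>)"
        and k = "\<lambda>j \<omega>. U j \<omega> * (X (Suc j) \<omega> - X j \<omega>) / l"])
    fix j \<omega> assume j: "j < n"
    have "(U j \<omega> / \<epsilon>)\<^sup>2 \<le> 1" using bd[OF j, of \<omega>] \<open>\<epsilon> > 0\<close> by (simp add: abs_square_le_1)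
    from mult_left_mono[OF this, of "(Y j \<omega> / l)\<^sup>2"]
    show "(Y j \<omega> * U j \<omega> / (l * \<epsilon>))\<^sup>2 \<le> (Y j \<omega> / l)\<^sup>2"
      by (simp add: power_mult_distrib power_divide)
    show "(U j \<omega> * (X (Suc j) \<omega> - X j \<omega>) / l)\<^sup>2 \<le> (\<epsilon> / l * (X (Suc j) \<omega> - X j \<omega>))\<^sup>2"
      unfolding abs_le_square_iff[symmetric] using bd[OF j, of \<omega>] assms(3,4)
      by (auto simp: abs_mult intro!: divide_right_mono mult_right_mono)
    show "(Y (Suc j) \<omega> / l)\<^sup>2 = (Y j \<omega> / l)\<^sup>2 + 2 * (Y j \<omega> * U j \<omega> / (l * \<epsilon>)) *
         (\<epsilon> / l * (X (Suc j) \<omega> - X j \<omega>)) + (U j \<omega> * (X (Suc j) \<omega> - X j \<omega>) / l)\<^sup>2"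
      using assms(3,4) by (simp add: Y_def field_simps power2_eq_square)
  qed (use Y U in \<open>auto simp: Y_def[of 0]\<close>)
  moreover have "1 \<le> (Y n \<omega> / l)\<^sup>2 \<longleftrightarrow> l \<le> \<bar>Y n \<omega>\<bar>" for \<omega>
    using abs_le_square_iff[of 1 "Y n \<omega> / l"] assms(4) by (auto simp: field_simps)
  ultimately show ?thesis using assms(3,4) by (simp add: Y_def)
qed

text \<open>The square function grows by pure squares, so \<open>weak_type\<close> applies with
  \<open>c = 0\<close> and the scaling \<open>a = 1 / sqrt l\<close>.\<close>

lemma square_function_weak_type:
  assumes "l > 0"
  shows "measure M {\<omega> \<in> space M. (\<Sum>j<n. (X (Suc j) \<omega> - X j \<omega>)\<^sup>2) \<ge> l}
    \<le> 2 / sqrt l * (\<integral>\<omega>. \<bar>X n \<omega>\<bar> \<partial>M)"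
proof -
  define W where "W m \<omega> = (\<Sum>j<m. (X (Suc j) \<omega> - X j \<omega>)\<^sup>2) / l" for m \<omega>
  have W: "W m \<in> borel_measurable (F m)" if "m \<le> n" for m
    using that
  proof (induction m)
    case 0
    then show ?case by (simp add: W_def)
  next
    case (Suc m)
    have "W m \<in> borel_measurable (F (Suc m))"
      using measurable_Suc[of m] Suc by auto
    moreover have "W (Suc m) = (\<lambda>\<omega>. W m \<omega> + (X (Suc m) \<omega> - X m \<omega>)\<^sup>2 / l)"
      by (auto simp: W_def add_divide_distrib)
    ultimately show ?case using increment_measurable[of m] Suc(2) by auto
  qed
  have "measure M {\<omega> \<in> space M. 1 \<le> W n \<omega>} \<le> 2 * \<bar>1 / sqrt l\<bar> * (\<integral>\<omega>. \<bar>X n \<omega>\<bar> \<partial>M)"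
  proof (rule weak_type[where c = "\<lambda>_ _. 0" and k = "\<lambda>j \<omega>. (X (Suc j) \<omega> - X j \<omega>) / sqrt l"])
    show "W j \<in> borel_measurable (F j)" if "j \<le> n" for j using W that .
  qed (use assms in \<open>auto simp: W_def add_divide_distrib power_divide intro!: sum_nonneg divide_nonneg_pos\<close>)
  moreover have "1 \<le> W n \<omega> \<longleftrightarrow> l \<le> (\<Sum>j<n. (X (Suc j) \<omega> - X j \<omega>)\<^sup>2)" for \<omega>
    using assms by (auto simp: W_def)
  ultimately show ?thesis using assms by simp
qed

end

section \<open>Cadlag paths along partitions\<close>

text \<open>By compactness: the one-sided limits give each time a neighbourhood on whose left and
  right halves the path moves by less than \<open>\<eta>\<close>, and finitely many of these cover
  \<open>[0, T]\<close>. The interval contains \<open>t\<close> but not \<open>s\<close>, since a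
  jump at \<open>t\<close> separates the two values and one at \<open>s\<close> does not.\<close>

lemma cadlag_oscillation:
  fixes x :: "real \<Rightarrow> real"
  assumes x: "cadlag_on T x" and "\<eta> > 0"
  obtains U where "finite U"
    "\<And>s t. \<lbrakk>0 \<le> s; s \<le> t; t \<le> T; U \<inter> {s<..t} = {}\<rbrakk> \<Longrightarrow> \<bar>x s - x t\<bar> < \<eta>"
proof -
  have "\<exists>d>0. (\<forall>s\<in>{t-d<..<t} \<inter> {0..T}. \<forall>s'\<in>{t-d<..<t} \<inter> {0..T}. \<bar>x s - x s'\<bar> < \<eta>) \<and>
          (\<forall>s\<in>{t..<t+d} \<inter> {0..T}. \<forall>s'\<in>{t..<t+d} \<inter> {0..T}. \<bar>x s - x s'\<bar> < \<eta>)"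
    if t: "t \<in> {0..T}" for t
  proof -
    have "\<exists>d>0. \<forall>s\<in>{t-d<..<t} \<inter> {0..T}. \<forall>s'\<in>{t-d<..<t} \<inter> {0..T}. \<bar>x s - x s'\<bar> < \<eta>"
    proof (cases "t = 0")
      case True
      then show ?thesis by (intro exI[of _ 1]) auto
    next
      case False
      then obtain l where "(x \<longlongrightarrow> l) (at_left t)" using x t unfolding cadlag_on_def by force
      hence "\<forall>\<^sub>F s in at_left t. dist (x s) l < \<eta> / 2" using assms(2) by (intro tendstoD) auto
      then obtain b where b: "b < t" "\<And>s. b < s \<Longrightarrow> s < t \<Longrightarrow> dist (x s) l < \<eta> / 2"
        unfolding eventually_at_left_field by auto
      have "\<bar>x s - x s'\<bar> < \<eta>" if "b < s" "s < t" "b < s'" "s' < t" for s s'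
        using b(2)[of s] b(2)[of s'] that unfolding dist_real_def by linarith
      thus ?thesis using b(1) by (intro exI[of _ "t - b"]) auto
    qed
    then obtain d1 where d1: "d1 > 0"
      "\<And>s s'. s \<in> {t-d1<..<t} \<inter> {0..T} \<Longrightarrow> s' \<in> {t-d1<..<t} \<inter> {0..T} \<Longrightarrow> \<bar>x s - x s'\<bar> < \<eta>" by blast
    have "\<exists>d>0. \<forall>s\<in>{t..<t+d} \<inter> {0..T}. \<forall>s'\<in>{t..<t+d} \<inter> {0..T}. \<bar>x s - x s'\<bar> < \<eta>"
    proof (cases "t = T")
      case True
      then show ?thesis using assms(2) by (intro exI[of _ 1]) auto
    next
      case False
      then have "(x \<longlongrightarrow> x t) (at_right t)" using x t unfolding cadlag_on_def by force
      hence "\<forall>\<^sub>F s in at_right t. dist (x s) (x t) < \<eta> / 2" using assms(2) by (intro tendstoD) auto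
      then obtain b where b: "b > t" "\<And>s. t < s \<Longrightarrow> s < b \<Longrightarrow> dist (x s) (x t) < \<eta> / 2"
        unfolding eventually_at_right_field by auto
      have b': "dist (x s) (x t) < \<eta> / 2" if "t \<le> s" "s < b" for s
        using b(2)[of s] that assms(2) by (cases "s = t") auto
      have "\<bar>x s - x s'\<bar> < \<eta>" if "t \<le> s" "s < b" "t \<le> s'" "s' < b" for s s'
        using b'[of s] b'[of s'] that unfolding dist_real_def by linarith
      thus ?thesis using b(1) by (intro exI[of _ "b - t"]) auto
    qed
    then obtain d2 where d2: "d2 > 0"
      "\<And>s s'. s \<in> {t..<t+d2} \<inter> {0..T} \<Longrightarrow> s' \<in> {t..<t+d2} \<inter> {0..T} \<Longrightarrow> \<bar>x s - x s'\<bar> < \<eta>" by blast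
    show ?thesis
      using d1 d2 by (intro exI[of _ "min d1 d2"]) auto
  qed
  then obtain d where d: "\<And>t. t \<in> {0..T} \<Longrightarrow> d t > 0"
    "\<And>t s s'. \<lbrakk>t \<in> {0..T}; s \<in> {t - d t<..<t} \<inter> {0..T}; s' \<in> {t - d t<..<t} \<inter> {0..T}\<rbrakk> \<Longrightarrow> \<bar>x s - x s'\<bar> < \<eta>"
    "\<And>t s s'. \<lbrakk>t \<in> {0..T}; s \<in> {t..<t + d t} \<inter> {0..T}; s' \<in> {t..<t + d t} \<inter> {0..T}\<rbrakk> \<Longrightarrow> \<bar>x s - x s'\<bar> < \<eta>"
    by metis
  have "{0..T} \<subseteq> (\<Union>t\<in>{0..T}. {t - d t<..<t + d t})"
    using d(1) by (auto intro!: bexI)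
  then obtain C where C: "C \<subseteq> {0..T}" "finite C" "{0..T} \<subseteq> (\<Union>t\<in>C. {t - d t<..<t + d t})"
    by (rule compactE_image[OF compact_Icc, rotated]) auto
  \<comment> \<open>Centres and right ends. If \<open>s\<close> lies in the neighbourhood of
    \<open>c\<close> and neither point lies in \<open>(s, t]\<close>, then \<open>t\<close> lies in
    the same half of that neighbourhood.\<close>
  let ?U = "C \<union> (\<lambda>t. t + d t) ` C"
  show ?thesis
  proof (rule that[of ?U])
    show "finite ?U" using C by auto
    fix s t assume st: "0 \<le> s" "s \<le> t" "t \<le> T" "?U \<inter> {s<..t} = {}"
    then obtain c where c: "c \<in> C" "c - d c < s" "s < c + d c" using C(3) by fastforce
    have nc: "c \<notin> {s<..t}" "c + d c \<notin> {s<..t}" using st(4) c(1) by auto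
    show "\<bar>x s - x t\<bar> < \<eta>"
    proof (cases "c \<le> s")
      case True
      then show ?thesis using d(3)[of c s t] nc c C(1) st by auto
    next
      case False
      then show ?thesis using d(2)[of c s t] nc c C(1) st by auto
    qed
  qed
qed

text \<open>Every value is within 1 of the value at the last preceding point of a finite set, to
  which 0 is added so that such a point exists.\<close>

lemma cadlag_bounded:
  fixes x :: "real \<Rightarrow> real"
  assumes x: "cadlag_on T x"
  obtains C where "C \<ge> 0" "\<And>t. t \<in> {0..T} \<Longrightarrow> \<bar>x t\<bar> \<le> C"
proof -
  obtain U where U: "finite U"
    "\<And>s t. \<lbrakk>0 \<le> s; s \<le> t; t \<le> T; U \<inter> {s<..t} = {}\<rbrakk> \<Longrightarrow> \<bar>x s - x t\<bar> < 1"
    using cadlag_oscillation[OF x, of 1] by auto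
  define C where "C = 1 + (\<Sum>u\<in>insert 0 U. \<bar>x u\<bar>)"
  have "\<bar>x t\<bar> \<le> C" if t: "t \<in> {0..T}" for t
  proof -
    define V where "V = insert 0 U \<inter> {0..t}"
    have V: "finite V" "V \<noteq> {}" using U t by (auto simp: V_def)
    define w where "w = Max V"
    have w: "w \<in> insert 0 U" "0 \<le> w" "w \<le> t"
      using Max_in[OF V] unfolding w_def[symmetric] by (auto simp: V_def)
    have "u \<le> w" if "u \<in> U" "0 \<le> u" "u \<le> t" for u
      unfolding w_def using that V by (intro Max_ge) (auto simp: V_def)
    hence "U \<inter> {w<..t} = {}" using w(2) by force
    hence "\<bar>x w - x t\<bar> < 1" using w t by (intro U) simp_all
    moreover have "\<bar>x w\<bar> \<le> (\<Sum>u\<in>insert 0 U. \<bar>x u\<bar>)"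
      by (rule member_le_sum) (use w U(1) in simp_all)
    ultimately show ?thesis by (simp add: C_def)
  qed
  moreover have "C \<ge> 0" unfolding C_def by (intro add_nonneg_nonneg sum_nonneg) auto
  ultimately show ?thesis using that by blast
qed

section \<open>Hysteresis and its error on a single block\<close>

text \<open>\<open>B\<close> holds the indices at which the blocks of the coarse partition start;
  index 0 always counts as a start. The value at \<open>j\<close> depends only on the path up to
  \<open>j\<close>, which keeps it adapted when \<open>x\<close> is a sampled martingale.\<close>

primrec hyst :: "real \<Rightarrow> nat set \<Rightarrow> (nat \<Rightarrow> real) \<Rightarrow> nat \<Rightarrow> real" where
  "hyst \<epsilon> B x 0 = x 0"
| "hyst \<epsilon> B x (Suc j) =
     (if Suc j \<in> B \<or> \<bar>x (Suc j) - hyst \<epsilon> B x j\<bar> > \<epsilon> then x (Suc j) else hyst \<epsilon> B x j)"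

primrec block_start :: "nat set \<Rightarrow> (nat \<Rightarrow> real) \<Rightarrow> nat \<Rightarrow> real" where
  "block_start B x 0 = x 0"
| "block_start B x (Suc j) = (if Suc j \<in> B then x (Suc j) else block_start B x j)"

lemma hyst_close: "\<epsilon> \<ge> 0 \<Longrightarrow> \<bar>x j - hyst \<epsilon> B x j\<bar> \<le> \<epsilon>"
  by (cases j) auto

lemma hyst_at_start: "a \<in> B \<or> a = 0 \<Longrightarrow> hyst \<epsilon> B x a = x a"
  by (cases a) auto

lemma block_start_eq:
  assumes "a \<in> B \<or> a = 0" "B \<inter> {a<..<c} = {}" "a \<le> j" "j < c"
  shows "block_start B x j = x a"
  using assms(3,4)
proof (induction j rule: dec_induct)
  case base
  then show ?case using assms(1) by (cases a) auto
next
  case (step j)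
  then show ?case using assms(2) by auto
qed

text \<open>Discrete integration by parts: the square of the increment over the block is expanded
  one step at a time.\<close>

lemma block_sum_squares:
  fixes x :: "nat \<Rightarrow> real"
  assumes "a \<le> c"
  shows "(\<Sum>j=a..<c. (x (Suc j) - x j)\<^sup>2) =
    (x c - x a)\<^sup>2 - 2 * (\<Sum>j=a..<c. (x j - x a) * (x (Suc j) - x j))"
  using assms by (induction c rule: dec_induct) (auto simp: power2_eq_square algebra_simps)

text \<open>No reset ever happens, so all factors vanish. The end \<open>c\<close> is left out of
  the hypothesis because the last multiplier is the one at \<open>c - 1\<close>.\<close>

lemma hyst_block_trivial:
  assumes "a \<in> B \<or> a = 0" "B \<inter> {a<..<c} = {}"
    and "\<And>i. a \<le> i \<Longrightarrow> i < c \<Longrightarrow> \<bar>x i - x a\<bar> \<le> \<epsilon>"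
  shows "(\<Sum>j=a..<c. (hyst \<epsilon> B x j - x a) * (x (Suc j) - x j)) = 0"
proof (rule sum.neutral, rule ballI)
  fix j assume "j \<in> {a..<c}"
  hence "a \<le> j" "j < c" by auto
  hence "hyst \<epsilon> B x j = x a"
  proof (induction j rule: dec_induct)
    case base
    then show ?case using hyst_at_start assms(1) by auto
  next
    case (step j)
    then show ?case using assms(2) assms(3)[of "Suc j"] by auto
  qed
  thus "(hyst \<epsilon> B x j - x a) * (x (Suc j) - x j) = 0" by simp
qed

text \<open>\<open>P\<close> is the predicate of lying behind the only jump of the block. The value is recorded at most
  once inside the block, at some \<open>e\<close> behind the jump, and then the sum telescopes to
  \<open>(x e - x a) * (x c - x e)\<close>.\<close>

lemma hyst_block_one_jump:
  assumes a: "a \<in> B \<or> a = 0" and B: "B \<inter> {a<..<c} = {}" and "a < c"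
    and nP: "\<not> P a" and mono: "\<And>i j. \<lbrakk>a \<le> i; i \<le> j; j \<le> c; P i\<rbrakk> \<Longrightarrow> P j"
    and osc: "\<And>i j. \<lbrakk>a \<le> i; i \<le> c; a \<le> j; j \<le> c; P i = P j\<rbrakk> \<Longrightarrow> \<bar>x i - x j\<bar> \<le> \<eta>"
    and "\<eta> \<le> \<epsilon>" and C: "\<And>i. a \<le> i \<Longrightarrow> i \<le> c \<Longrightarrow> \<bar>x i\<bar> \<le> C"
  shows "\<bar>\<Sum>j=a..<c. (hyst \<epsilon> B x j - x a) * (x (Suc j) - x j)\<bar> \<le> 2 * C * \<eta>"
proof -
  define S where "S k = (\<Sum>j=a..<k. (hyst \<epsilon> B x j - x a) * (x (Suc j) - x j))" for k
  have Suc_S: "S (Suc k) = S k + (hyst \<epsilon> B x k - x a) * (x (Suc k) - x k)" if "a \<le> k" for k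
    using that by (simp add: S_def)
  have inv: "(hyst \<epsilon> B x k = x a \<and> S k = 0) \<or>
      (\<exists>e. a \<le> e \<and> e \<le> k \<and> P e \<and> hyst \<epsilon> B x k = x e \<and> S k = (x e - x a) * (x k - x e))"
    if "a \<le> k" "k < c" for k
    using that
  proof (induction k rule: dec_induct)
    case base
    then show ?case using hyst_at_start[OF a] by (auto simp: S_def)
  next
    case (step k)
    have nB: "Suc k \<notin> B" using step B by auto
    from step have "(hyst \<epsilon> B x k = x a \<and> S k = 0) \<or>
      (\<exists>e. a \<le> e \<and> e \<le> k \<and> P e \<and> hyst \<epsilon> B x k = x e \<and> S k = (x e - x a) * (x k - x e))" by auto
    then show ?case
    proof (elim disjE exE conjE)
      assume h: "hyst \<epsilon> B x k = x a" "S k = 0"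
      show ?thesis
      proof (cases "\<bar>x (Suc k) - x a\<bar> > \<epsilon>")
        case True
        \<comment> \<open>A deviation from \<open>x a\<close> by more than
          \<open>\<epsilon> \<ge> \<eta>\<close> can only occur behind the jump. The reset index
          \<open>e = Suc k\<close> fits the invariant because the factor
          \<open>x (Suc k) - x e\<close> is 0.\<close>
        hence "P (Suc k)" using osc[of "Suc k" a] nP step \<open>\<eta> \<le> \<epsilon>\<close> \<open>a < c\<close> by force
        then show ?thesis using h True nB Suc_S[of k] step by (intro disjI2 exI[of _ "Suc k"]) auto
      next
        case False
        then show ?thesis using h nB Suc_S[of k] step by auto
      qed
    next
      fix e assume e: "a \<le> e" "e \<le> k" "P e" "hyst \<epsilon> B x k = x e" "S k = (x e - x a) * (x k - x e)"
      \<comment> \<open>Behind the jump the values differ by at most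
        \<open>\<eta> \<le> \<epsilon>\<close>, so there is no second reset.\<close>
      have "P (Suc k)" using mono[of e "Suc k"] e step by auto
      hence "\<bar>x (Suc k) - x e\<bar> \<le> \<epsilon>" using osc[of "Suc k" e] e step \<open>\<eta> \<le> \<epsilon>\<close> by auto
      then show ?thesis using e nB Suc_S[of k] step
        by (intro disjI2 exI[of _ e]) (auto simp: algebra_simps)
    qed
  qed
  \<comment> \<open>The invariant stops at \<open>c - 1\<close>, because \<open>c\<close> may itself
    lie in \<open>B\<close>; the last summand is added separately.\<close>
  obtain k where k: "c = Suc k" "a \<le> k" using \<open>a < c\<close> by (cases c) auto
  have "0 \<le> \<eta>" using osc[of a a] \<open>a < c\<close> by auto
  moreover have "0 \<le> C" using C[of a] \<open>a < c\<close> by auto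
  ultimately have "0 \<le> 2 * C * \<eta>" by simp
  moreover have "\<bar>S c\<bar> \<le> 2 * C * \<eta>"
    if e: "a \<le> e" "e \<le> k" "P e" "hyst \<epsilon> B x k = x e" "S k = (x e - x a) * (x k - x e)" for e
  proof -
    have "S c = (x e - x a) * (x c - x e)"
      using Suc_S[of k] e k by (simp add: algebra_simps)
    moreover have "\<bar>x e - x a\<bar> \<le> 2 * C" using C[of e] C[of a] e k by auto
    moreover have "\<bar>x c - x e\<bar> \<le> \<eta>" using osc[of c e] mono[of e c] e k by auto
    ultimately show ?thesis by (auto simp: abs_mult intro!: mult_mono)
  qed
  moreover have "S c = 0" if "hyst \<epsilon> B x k = x a" "S k = 0"
    using Suc_S[of k] that k by simp
  ultimately have "\<bar>S c\<bar> \<le> 2 * C * \<eta>" using inv[of k] k by auto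
  thus ?thesis by (simp add: S_def)
qed

section \<open>Partitions, refinements and the error along a whole path\<close>

lemma sum_blocks:
  fixes f :: "nat \<Rightarrow> real"
  assumes "m 0 = 0" "\<And>b. b < N \<Longrightarrow> m b \<le> m (Suc b)"
  shows "(\<Sum>j<m N. f j) = (\<Sum>b<N. \<Sum>j=m b..<m (Suc b). f j)"
  using assms(2)
proof (induction N)
  case 0
  then show ?case using assms(1) by simp
next
  case (Suc N)
  have "(\<Sum>j<m (Suc N). f j) = (\<Sum>j<m N. f j) + (\<Sum>j=m N..<m (Suc N). f j)"
    using Suc(2)[of N] sum.atLeastLessThan_concat[of 0 "m N" "m (Suc N)" f]
    by (simp add: atLeast0LessThan)
  then show ?case using Suc by simp
qed

lemma is_partition_mono:
  assumes "is_partition t N p" "i \<le> j" "j \<le> N" shows "p i \<le> p j"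
  using assms(2,3)
proof (induction j rule: dec_induct)
  case (step j)
  then have "p j < p (Suc j)" using assms(1) by (auto simp: is_partition_def)
  then show ?case using step by auto
qed auto

lemma is_partition_range:
  assumes "is_partition t N p" "j \<le> N" shows "p j \<in> {0..t}"
  using is_partition_mono[OF assms(1), of 0 j] is_partition_mono[OF assms(1), of j N] assms
  by (auto simp: is_partition_def)

text \<open>\<open>m b\<close> is the index in \<open>r\<close> of the point \<open>p b\<close>.
  Recording this map, rather than an inclusion of point sets, makes the blocks index ranges.\<close>

definition refinement :: "real \<Rightarrow> nat \<Rightarrow> (nat \<Rightarrow> real) \<Rightarrow> nat \<Rightarrow> (nat \<Rightarrow> real) \<Rightarrow> (nat \<Rightarrow> nat) \<Rightarrow> bool" where
  "refinement t N p n r m \<longleftrightarrow> is_partition t N p \<and> is_partition t n r \<and>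
     m 0 = 0 \<and> m N = n \<and> (\<forall>b<N. m b < m (Suc b)) \<and> (\<forall>b\<le>N. p b = r (m b))"

lemma refinement_mono:
  assumes "refinement t N p n r m" "i \<le> j" "j \<le> N" shows "m i \<le> m j"
  using assms(2,3)
proof (induction j rule: dec_induct)
  case (step j)
  then have "m j < m (Suc j)" using assms(1) by (auto simp: refinement_def)
  then show ?case using step by auto
qed auto

lemma refinement_block:
  assumes "refinement t N p n r m" "b < N"
  shows "m ` {..N} \<inter> {m b<..<m (Suc b)} = {}" "m b < m (Suc b)" "m (Suc b) \<le> n" "m b \<in> m ` {..N}"
proof -
  show "m ` {..N} \<inter> {m b<..<m (Suc b)} = {}"
  proof -
    have "m i \<notin> {m b<..<m (Suc b)}" if "i \<le> N" for i
      using refinement_mono[OF assms(1), of i b] refinement_mono[OF assms(1), of "Suc b" i] assms(2) that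
      by (cases "i \<le> b") auto
    thus ?thesis by blast
  qed
  show "m b < m (Suc b)" "m (Suc b) \<le> n" "m b \<in> m ` {..N}"
    using assms refinement_mono[OF assms(1), of "Suc b" N] by (auto simp: refinement_def)
qed

definition sq_sum :: "(real \<Rightarrow> real) \<Rightarrow> nat \<Rightarrow> (nat \<Rightarrow> real) \<Rightarrow> real" where
  "sq_sum x N p = (\<Sum>i<N. (x (p (Suc i)) - x (p i))\<^sup>2)"

text \<open>\<open>block_sum_squares\<close> summed over the blocks, on each of which
  \<open>block_start\<close> is constant.\<close>

lemma sq_sum_refinement:
  assumes "refinement t N p n r m"
  defines "B \<equiv> m ` {..N}"
  shows "sq_sum x n r - sq_sum x N p =
    - 2 * (\<Sum>j<n. (x (r j) - block_start B (\<lambda>j. x (r j)) j) * (x (r (Suc j)) - x (r j)))"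
proof -
  have m: "m 0 = 0" "m N = n" "\<And>b. b < N \<Longrightarrow> m b \<le> m (Suc b)" "\<And>b. b \<le> N \<Longrightarrow> p b = r (m b)"
    using assms(1) by (auto simp: refinement_def intro: less_imp_le)
  have "(\<Sum>j=m b..<m (Suc b). (x (r (Suc j)) - x (r j))\<^sup>2) = (x (p (Suc b)) - x (p b))\<^sup>2 -
     2 * (\<Sum>j=m b..<m (Suc b). (x (r j) - block_start B (\<lambda>j. x (r j)) j) * (x (r (Suc j)) - x (r j)))"
    if b: "b < N" for b
  proof -
    have "block_start B (\<lambda>j. x (r j)) j = x (r (m b))" if "j \<in> {m b..<m (Suc b)}" for j
      using block_start_eq[of "m b" B "m (Suc b)" j "\<lambda>j. x (r j)"] refinement_block[OF assms(1) b] that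
      by (auto simp: B_def)
    thus ?thesis using block_sum_squares[OF m(3)[OF b], of "\<lambda>j. x (r j)"] m(4) b by simp
  qed
  note sq = this
  have blocks: "(\<Sum>j<n. f j) = (\<Sum>b<N. \<Sum>j=m b..<m (Suc b). f j)" for f :: "nat \<Rightarrow> real"
    using sum_blocks[of m N f] m by simp
  show ?thesis
    unfolding sq_sum_def blocks by (simp add: sq sum_subtractf sum_distrib_left sum_negf)
qed

text \<open>Bounds the number of cells meeting \<open>U\<close> by \<open>card U\<close>, uniformly
  in the partition.\<close>

lemma sum_card_cells:
  fixes U :: "real set"
  assumes "finite U" "\<And>b. b < N \<Longrightarrow> p b \<le> p (Suc b)"
  shows "(\<Sum>b<N. card (U \<inter> {p b<..p (Suc b)})) = card (U \<inter> {p 0<..p N})"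
  using assms(2)
proof (induction N)
  case (Suc N)
  have "p 0 \<le> p N"
  proof -
    have "i \<le> N \<Longrightarrow> p 0 \<le> p i" for i
      by (induction i) (use Suc(2) in \<open>auto intro: order.trans\<close>)
    thus ?thesis by simp
  qed
  hence "U \<inter> {p 0<..p (Suc N)} = (U \<inter> {p 0<..p N}) \<union> (U \<inter> {p N<..p (Suc N)})"
    using Suc(2)[of N] by auto
  moreover have "card ((U \<inter> {p 0<..p N}) \<union> (U \<inter> {p N<..p (Suc N)})) =
      card (U \<inter> {p 0<..p N}) + card (U \<inter> {p N<..p (Suc N)})"
    using assms(1) by (intro card_Un_disjoint) auto
  moreover have "(\<Sum>b<N. card (U \<inter> {p b<..p (Suc b)})) = card (U \<inter> {p 0<..p N})"
    using Suc(2) by (intro Suc(1)) (meson less_SucI)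
  ultimately show ?case unfolding sum.lessThan_Suc by metis
qed simp

lemma finite_gap:
  fixes U :: "real set"
  assumes "finite U"
  obtains d where "d > 0" "\<And>u v. u \<in> U \<Longrightarrow> v \<in> U \<Longrightarrow> u < v \<Longrightarrow> d \<le> v - u"
proof -
  \<comment> \<open>The element 1 keeps \<open>G\<close> nonempty when \<open>U\<close> has fewer
    than two points.\<close>
  define G where "G = insert 1 ((\<lambda>(u, v). v - u) ` {(u, v) \<in> U \<times> U. u < v})"
  have "finite {(u, v) \<in> U \<times> U. u < v}"
    by (rule finite_subset[of _ "U \<times> U"]) (use assms in auto)
  hence fin: "finite G" unfolding G_def by (intro finite.insertI finite_imageI)
  show ?thesis
  proof (rule that[of "Min G"])
    have "Min G \<in> G" by (rule Min_in[OF fin]) (simp add: G_def)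
    moreover have "g > 0" if "g \<in> G" for g using that by (auto simp: G_def)
    ultimately show "Min G > 0" by blast
    fix u v assume "u \<in> U" "v \<in> U" "u < v"
    hence "v - u \<in> G" by (auto simp: G_def)
    thus "Min G \<le> v - u" by (rule Min_le[OF fin])
  qed
qed

text \<open>Only boundedly many blocks contain an oscillation larger than \<open>\<epsilon>\<close>, and each of them contributes
  at most \<open>2 * C * \<eta>\<close> for arbitrarily small \<open>\<eta>\<close>, since a cadlag path hardly moves between the jump and
  the end of a short block.\<close>

lemma hyst_error_small:
  fixes x :: "real \<Rightarrow> real"
  assumes x: "cadlag_on T x" and "\<epsilon> > 0" "\<theta> > 0"
  shows "\<exists>\<delta>>0. \<forall>N p n r m. refinement T N p n r m \<and> (\<forall>i<N. p (Suc i) - p i < \<delta>) \<longrightarrow>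
    \<bar>\<Sum>j<n. (hyst \<epsilon> (m ` {..N}) (\<lambda>j. x (r j)) j - block_start (m ` {..N}) (\<lambda>j. x (r j)) j)
        * (x (r (Suc j)) - x (r j))\<bar> \<le> \<theta>"
proof -
  obtain U where U: "finite U"
    "\<And>s t. \<lbrakk>0 \<le> s; s \<le> t; t \<le> T; U \<inter> {s<..t} = {}\<rbrakk> \<Longrightarrow> \<bar>x s - x t\<bar> < \<epsilon>"
    using cadlag_oscillation[OF x \<open>\<epsilon> > 0\<close>] by metis
  obtain C where C: "C \<ge> 0" "\<And>t. t \<in> {0..T} \<Longrightarrow> \<bar>x t\<bar> \<le> C"
    using cadlag_bounded[OF x] by metis
  \<comment> \<open>At most \<open>card U\<close> blocks contribute, each at most
    \<open>2 * C * \<eta>\<close>; the summand 1 makes \<open>D\<close> a positive divisor.\<close>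
  define D where "D = 2 * C * card U + 1"
  have D: "D > 0" using C(1) by (auto simp: D_def intro!: add_nonneg_pos mult_nonneg_nonneg)
  define \<eta> where "\<eta> = min \<epsilon> (\<theta> / D)"
  have \<eta>: "\<eta> > 0" "\<eta> \<le> \<epsilon>" using assms D by (auto simp: \<eta>_def)
  have "D * \<eta> \<le> D * (\<theta> / D)" using D by (intro mult_left_mono) (auto simp: \<eta>_def)
  hence "D * \<eta> \<le> \<theta>" using D by simp
  hence \<eta>\<theta>: "2 * C * \<eta> * card U \<le> \<theta>" using \<eta> by (simp add: D_def algebra_simps)
  obtain V where V: "finite V"
    "\<And>s t. \<lbrakk>0 \<le> s; s \<le> t; t \<le> T; V \<inter> {s<..t} = {}\<rbrakk> \<Longrightarrow> \<bar>x s - x t\<bar> < \<eta>"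
    using cadlag_oscillation[OF x \<eta>(1)] by metis
  \<comment> \<open>\<open>U\<close> locates the oscillations of size \<open>\<epsilon>\<close>,
    \<open>V\<close> those of the smaller size \<open>\<eta>\<close>. A mesh below the gaps of
    \<open>V\<close> leaves at most one point of \<open>V\<close> in each block.\<close>
  obtain \<delta> where \<delta>: "\<delta> > 0" "\<And>u v. u \<in> V \<Longrightarrow> v \<in> V \<Longrightarrow> u < v \<Longrightarrow> \<delta> \<le> v - u"
    using finite_gap[OF V(1)] by metis
  show ?thesis
  proof (intro exI[of _ \<delta>] conjI allI impI; (elim conjE)?)
    fix N p n r m
    assume ref: "refinement T N p n r m" and mesh: "\<forall>i<N. p (Suc i) - p i < \<delta>"
    define B where "B = m ` {..N}"
    define y where "y j = x (r j)" for j
    have m: "m 0 = 0" "m N = n" "\<And>b. b < N \<Longrightarrow> m b \<le> m (Suc b)" "\<And>b. b \<le> N \<Longrightarrow> p b = r (m b)"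
      and part: "is_partition T n r" "is_partition T N p"
      using ref by (auto simp: refinement_def intro: less_imp_le)
    have blocks: "(\<Sum>j<n. f j) = (\<Sum>b<N. \<Sum>j=m b..<m (Suc b). f j)" for f :: "nat \<Rightarrow> real"
      using sum_blocks[of m N f] m by simp
    have r: "r i \<in> {0..T}" if "i \<le> n" for i using is_partition_range part that by auto
    have block: "\<bar>\<Sum>j=m b..<m (Suc b). (hyst \<epsilon> B y j - block_start B y j) * (y (Suc j) - y j)\<bar>
      \<le> 2 * C * \<eta> * card (U \<inter> {p b<..p (Suc b)})" if b: "b < N" for b
    proof -
      note rb = refinement_block[OF ref b, folded B_def]
      have pb: "p b = r (m b)" "p (Suc b) = r (m (Suc b))" using m b by auto
      have rmono: "r i \<le> r j" if "i \<le> j" "j \<le> m (Suc b)" for i j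
        using is_partition_mono[OF part(1)] that rb by auto
      have "(\<Sum>j=m b..<m (Suc b). (hyst \<epsilon> B y j - block_start B y j) * (y (Suc j) - y j)) =
        (\<Sum>j=m b..<m (Suc b). (hyst \<epsilon> B y j - y (m b)) * (y (Suc j) - y j))"
        using block_start_eq[of "m b" B "m (Suc b)"] rb by (intro sum.cong) auto
      moreover have "\<bar>\<Sum>j=m b..<m (Suc b). (hyst \<epsilon> B y j - y (m b)) * (y (Suc j) - y j)\<bar>
        \<le> 2 * C * \<eta> * card (U \<inter> {p b<..p (Suc b)})"
      proof (cases "U \<inter> {p b<..p (Suc b)} = {}")
        case True
        have "(\<Sum>j=m b..<m (Suc b). (hyst \<epsilon> B y j - y (m b)) * (y (Suc j) - y j)) = 0"
        proof (rule hyst_block_trivial)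
          fix i assume i: "m b \<le> i" "i < m (Suc b)"
          have "U \<inter> {r (m b)<..r i} \<subseteq> U \<inter> {p b<..p (Suc b)}"
            using rmono[of i "m (Suc b)"] i pb by auto
          hence "\<bar>x (r (m b)) - x (r i)\<bar> < \<epsilon>"
            using True i rb r[of "m b"] r[of i] rmono[of "m b" i] by (intro U(2)) auto
          thus "\<bar>y i - y (m b)\<bar> \<le> \<epsilon>" by (simp add: y_def)
        qed (use rb in auto)
        then show ?thesis using C(1) \<eta> by simp
      next
        case False
        obtain v where v: "r (m b) < v" "V \<inter> {p b<..p (Suc b)} \<subseteq> {v}"
        proof (cases "V \<inter> {p b<..p (Suc b)} = {}")
          case True
          \<comment> \<open>Without a point of \<open>V\<close> in the block, any \<open>v\<close>
            beyond its first point will do.\<close>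
          then show ?thesis using that[of "r (m b) + 1"] by auto
        next
          case False
          then obtain v where v: "v \<in> V" "p b < v" "v \<le> p (Suc b)" by auto
          have "u = v" if u: "u \<in> V \<inter> {p b<..p (Suc b)}" for u
          proof (rule ccontr)
            have "p (Suc b) - p b < \<delta>" using mesh b by blast
            moreover assume "u \<noteq> v"
            ultimately show False
              using \<delta>(2)[of u v] \<delta>(2)[of v u] u v by (cases "u < v") auto
          qed
          hence "V \<inter> {p b<..p (Suc b)} \<subseteq> {v}" by blast
          then show ?thesis using that[of v] v(2) pb by simp
        qed
        have "\<bar>\<Sum>j=m b..<m (Suc b). (hyst \<epsilon> B y j - y (m b)) * (y (Suc j) - y j)\<bar> \<le> 2 * C * \<eta>"
        proof (rule hyst_block_one_jump[where P = "\<lambda>j. v \<le> r j"])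
          have *: "\<bar>y i - y j\<bar> \<le> \<eta>"
            if "m b \<le> i" "i \<le> j" "j \<le> m (Suc b)" "(v \<le> r i) = (v \<le> r j)" for i j
          proof -
            have "V \<inter> {r i<..r j} \<subseteq> V \<inter> {p b<..p (Suc b)}"
              using rmono[of "m b" i] rmono[of j "m (Suc b)"] that pb by auto
            moreover have "v \<notin> {r i<..r j}" using that by auto
            ultimately have "V \<inter> {r i<..r j} = {}" using v by blast
            hence "\<bar>x (r i) - x (r j)\<bar> < \<eta>"
              using that(1-3) rb(3) r[of i] r[of j] rmono[of i j] by (intro V(2)) auto
            thus ?thesis by (simp add: y_def)
          qed
          show "\<bar>y i - y j\<bar> \<le> \<eta>"
            if "m b \<le> i" "i \<le> m (Suc b)" "m b \<le> j" "j \<le> m (Suc b)" "(v \<le> r i) = (v \<le> r j)" for i j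
          proof (cases "i \<le> j")
            case True
            show ?thesis by (rule *[OF that(1) True that(4,5)])
          next
            case False
            show ?thesis
              using *[OF that(3) _ that(2) that(5)[symmetric]] False by (simp add: abs_minus_commute)
          qed
          show "v \<le> r j" if "m b \<le> i" "i \<le> j" "j \<le> m (Suc b)" "v \<le> r i" for i j
            using rmono[of i j] that by auto
          show "\<bar>y i\<bar> \<le> C" if "m b \<le> i" "i \<le> m (Suc b)" for i
            using C(2) r[of i] that rb by (auto simp: y_def)
        qed (use rb v \<eta> in auto)
        \<comment> \<open>Since the block meets \<open>U\<close>, its own share of
          \<open>card U\<close> pays for the error.\<close>
        moreover have "card (U \<inter> {p b<..p (Suc b)}) \<ge> 1"
          using False U(1) by (simp add: Suc_le_eq card_gt_0_iff)
        hence "2 * C * \<eta> * 1 \<le> 2 * C * \<eta> * card (U \<inter> {p b<..p (Suc b)})"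
          using C(1) \<eta> by (intro mult_left_mono) auto
        ultimately show ?thesis by linarith
      qed
      ultimately show ?thesis by simp
    qed
    have "\<bar>\<Sum>j<n. (hyst \<epsilon> B y j - block_start B y j) * (y (Suc j) - y j)\<bar>
      \<le> (\<Sum>b<N. 2 * C * \<eta> * card (U \<inter> {p b<..p (Suc b)}))"
      unfolding blocks by (rule order.trans[OF sum_abs], rule sum_mono) (use block in auto)
    also have "\<dots> = 2 * C * \<eta> * real (\<Sum>b<N. card (U \<inter> {p b<..p (Suc b)}))"
      by (simp add: sum_distrib_left)
    also have "(\<Sum>b<N. card (U \<inter> {p b<..p (Suc b)})) = card (U \<inter> {p 0<..p N})"
      using is_partition_mono[OF part(2)] by (intro sum_card_cells U) auto
    also have "2 * C * \<eta> * real (card (U \<inter> {p 0<..p N})) \<le> 2 * C * \<eta> * card U"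
      using C(1) \<eta> U(1) by (intro mult_left_mono) (auto intro!: card_mono)
    also note \<eta>\<theta>
    finally show "\<bar>\<Sum>j<n. (hyst \<epsilon> (m ` {..N}) (\<lambda>j. x (r j)) j - block_start (m ` {..N}) (\<lambda>j. x (r j)) j)
        * (x (r (Suc j)) - x (r j))\<bar> \<le> \<theta>"
      unfolding y_def[abs_def] B_def .
  qed (rule \<delta>(1))
qed

text \<open>\<open>R\<close> contains 0 and \<open>t\<close> as end points of \<open>p\<close>, so
  its increasing enumeration is a partition with one interval fewer than points, and
  \<open>m\<close> looks up the positions of the points of \<open>p\<close>.\<close>

lemma refinement_of_sorted_list:
  assumes p: "is_partition t N p" and fin: "finite R" and sub: "p ` {..N} \<subseteq> R" and R: "R \<subseteq> {0..t}"
  shows "\<exists>m. refinement t N p (card R - 1) (\<lambda>i. sorted_list_of_set R ! i) m"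
proof -
  define xs where "xs = sorted_list_of_set R"
  define n where "n = card R - 1"
  have xs: "set xs = R" "length xs = card R" "sorted_wrt (<) xs"
    using fin by (auto simp: xs_def)
  have "R \<noteq> {}" using sub by auto
  hence len: "length xs = Suc n" using fin xs(2) by (simp add: n_def card_gt_0_iff)
  have strict: "xs ! i < xs ! j" if "i < j" "j \<le> n" for i j
    using sorted_wrt_nth_less[OF xs(3), of i j] that len by simp
  have mono: "xs ! i \<le> xs ! j \<longleftrightarrow> i \<le> j" if "i \<le> n" "j \<le> n" for i j
    using strict[of i j] strict[of j i] that by (cases i j rule: linorder_cases) auto
  have inR: "xs ! i \<in> R" if "i \<le> n" for i using that len xs(1) nth_mem[of i xs] by auto
  have "\<exists>i\<le>n. xs ! i = p b" if "b \<le> N" for b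
  proof -
    have "p b \<in> set xs" using sub xs(1) that by auto
    thus ?thesis using len by (auto simp: in_set_conv_nth less_Suc_eq_le)
  qed
  then obtain m where m: "\<And>b. b \<le> N \<Longrightarrow> m b \<le> n" "\<And>b. b \<le> N \<Longrightarrow> xs ! m b = p b" by metis
  have p0: "p 0 = 0" "p N = t" "\<And>b. b < N \<Longrightarrow> p b < p (Suc b)" using p by (auto simp: is_partition_def)
  have m0: "m 0 = 0"
  proof -
    have "xs ! m 0 \<le> xs ! 0" using m(2)[of 0] p0 inR[of 0] R by auto
    thus ?thesis using mono[of "m 0" 0] m(1)[of 0] by auto
  qed
  have mN: "m N = n"
  proof -
    have "xs ! n \<le> xs ! m N" using m(2)[of N] p0 inR[of n] R by auto
    thus ?thesis using mono[of n "m N"] m(1)[of N] by auto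
  qed
  have "m b < m (Suc b)" if "b < N" for b
  proof -
    have "\<not> xs ! m (Suc b) \<le> xs ! m b" using m(2)[of b] m(2)[of "Suc b"] p0(3)[of b] that by auto
    thus ?thesis using mono[of "m (Suc b)" "m b"] m(1)[of b] m(1)[of "Suc b"] that by auto
  qed
  moreover have "is_partition t n (\<lambda>i. xs ! i)"
    unfolding is_partition_def using m(2)[of 0] m(2)[of N] m0 mN p0 strict by auto
  ultimately have "refinement t N p n (\<lambda>i. xs ! i) m"
    unfolding refinement_def using p m m0 mN by auto
  thus ?thesis unfolding xs_def n_def by blast
qed

text \<open>The enumeration depends only on the union of the two point sets, so the same
  \<open>r\<close> serves both partitions.\<close>

lemma common_refinement:
  assumes "is_partition t N p" "is_partition t N' q"
  obtains n r m m' where "refinement t N p n r m" "refinement t N' q n r m'"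
proof -
  define R where "R = p ` {..N} \<union> q ` {..N'}"
  have "finite R" "R \<subseteq> {0..t}" "p ` {..N} \<subseteq> R" "q ` {..N'} \<subseteq> R"
    using is_partition_range[OF assms(1)] is_partition_range[OF assms(2)] by (auto simp: R_def)
  thus ?thesis
    using refinement_of_sorted_list[OF assms(1), of R] refinement_of_sorted_list[OF assms(2), of R] that by metis
qed

definition fine_partition :: "real \<Rightarrow> real \<Rightarrow> nat \<Rightarrow> (nat \<Rightarrow> real) \<Rightarrow> bool" where
  "fine_partition t \<delta> N p \<longleftrightarrow> is_partition t N p \<and> (\<forall>i<N. p (Suc i) - p i < \<delta>)"

lemma fine_partition_mono: "fine_partition t \<delta> N p \<Longrightarrow> \<delta> \<le> \<delta>' \<Longrightarrow> fine_partition t \<delta>' N p"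
  by (force simp: fine_partition_def)

lemma exists_fine_partition:
  assumes "t > 0" "\<delta> > 0"
  shows "\<exists>N p. fine_partition t \<delta> N p"
proof -
  obtain k where k: "t / \<delta> < real k" using reals_Archimedean2 by blast
  have "0 < t / \<delta>" using assms by simp
  hence k0: "k > 0" using k by (intro gr0I) auto
  have "t / real k < \<delta>" using k k0 assms by (simp add: field_simps)
  thus ?thesis using k0 assms
    by (intro exI[of _ k] exI[of _ "\<lambda>i. t * real i / real k"])
       (auto simp: fine_partition_def is_partition_def field_simps)
qed

section \<open>Tools for convergence in probability\<close>

text \<open>Dominated convergence for indicators. It turns estimates whose threshold depends on the
  path into estimates in probability.\<close>

lemma (in prob_space) prob_tendsto_0:
  assumes [measurable]: "\<And>k. A k \<in> events" and "AE \<omega> in M. \<forall>\<^sub>F k in sequentially. \<omega> \<notin> A k"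
  shows "(\<lambda>k. prob (A k)) \<longlonglongrightarrow> 0"
proof -
  have "(\<lambda>k. \<integral>\<omega>. indicator (A k) \<omega> \<partial>M) \<longlonglongrightarrow> (\<integral>\<omega>. (0::real) \<partial>M)"
  proof (rule integral_dominated_convergence[where w = "\<lambda>_. 1"])
    show "AE \<omega> in M. (\<lambda>k. indicator (A k) \<omega> :: real) \<longlonglongrightarrow> 0"
      using assms(2)
    proof eventually_elim
      case (elim \<omega>)
      then show ?case by (intro tendsto_eventually) (auto elim!: eventually_mono)
    qed
  qed (auto simp: indicator_def)
  thus ?thesis by (simp add: assms(1))
qed

lemma (in prob_space) prob_triangle:
  fixes f g h :: "'a \<Rightarrow> real"
  assumes [measurable]: "f \<in> borel_measurable M" "g \<in> borel_measurable M" "h \<in> borel_measurable M"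
  shows "prob {\<omega> \<in> space M. \<bar>f \<omega> - h \<omega>\<bar> > a + b} \<le>
    prob {\<omega> \<in> space M. \<bar>f \<omega> - g \<omega>\<bar> > a} + prob {\<omega> \<in> space M. \<bar>g \<omega> - h \<omega>\<bar> > b}"
proof -
  have "prob {\<omega> \<in> space M. \<bar>f \<omega> - h \<omega>\<bar> > a + b} \<le>
    prob ({\<omega> \<in> space M. \<bar>f \<omega> - g \<omega>\<bar> > a} \<union> {\<omega> \<in> space M. \<bar>g \<omega> - h \<omega>\<bar> > b})"
    by (rule finite_measure_mono) auto
  also have "\<dots> \<le> prob {\<omega> \<in> space M. \<bar>f \<omega> - g \<omega>\<bar> > a} + prob {\<omega> \<in> space M. \<bar>g \<omega> - h \<omega>\<bar> > b}"
    by (rule measure_Un_le) measurable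
  finally show ?thesis .
qed

lemma convergent_if_geometric_increments:
  fixes y :: "nat \<Rightarrow> real"
  assumes "\<forall>\<^sub>F j in sequentially. \<bar>y j - y (Suc j)\<bar> \<le> (1/2)^j"
  shows "convergent y"
proof -
  have "summable (\<lambda>j. y (Suc j) - y j)"
  proof (rule summable_comparison_test_ev)
    show "\<forall>\<^sub>F j in sequentially. norm (y (Suc j) - y j) \<le> (1/2)^j"
      using assms by (simp add: abs_minus_commute)
  qed (simp add: summable_geometric)
  hence "(\<lambda>n. \<Sum>j<n. y (Suc j) - y j) \<longlonglongrightarrow> (\<Sum>j. y (Suc j) - y j)"
    by (rule summable_LIMSEQ)
  hence "(\<lambda>n. (y n - y 0) + y 0) \<longlonglongrightarrow> (\<Sum>j. y (Suc j) - y j) + y 0"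
    unfolding sum_lessThan_telescope by (intro tendsto_intros)
  thus ?thesis by (auto simp: convergent_def)
qed

lemma (in finite_martingale) hyst_measurable:
  "j \<le> n \<Longrightarrow> (\<lambda>\<omega>. hyst \<epsilon> B (\<lambda>j. X j \<omega>) j) \<in> borel_measurable (F j)"
proof (induction j)
  case 0
  then show ?case using adapted by simp
next
  case (Suc j)
  have [measurable]: "(\<lambda>\<omega>. hyst \<epsilon> B (\<lambda>j. X j \<omega>) j) \<in> borel_measurable (F (Suc j))"
    "X (Suc j) \<in> borel_measurable (F (Suc j))"
    using measurable_Suc[of j] Suc adapted by auto
  show ?case by simp
qed

lemma (in finite_martingale) block_start_measurable:
  "j \<le> n \<Longrightarrow> (\<lambda>\<omega>. block_start B (\<lambda>j. X j \<omega>) j) \<in> borel_measurable M"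
proof (induction j)
  case 0
  then show ?case using borel_measurable_integrable[OF integ] by simp
next
  case (Suc j)
  then show ?case using borel_measurable_integrable[OF integ, of "Suc j"] by auto
qed

section \<open>Quadratic variation of cadlag martingales\<close>

lemma has_quadratic_variation_iff:
  "has_quadratic_variation M X t V \<longleftrightarrow> V \<in> borel_measurable M \<and>
     (\<forall>N p. (\<forall>k. is_partition t (N k) (p k)) \<and>
        (\<forall>\<delta>>0. \<forall>\<^sub>F k in sequentially. \<forall>i<N k. p k (Suc i) - p k i < \<delta>) \<longrightarrow>
        (\<forall>\<epsilon>>0. (\<lambda>k. measure M {\<omega> \<in> space M. \<bar>sq_sum (\<lambda>t. X t \<omega>) (N k) (p k) - V \<omega>\<bar> > \<epsilon>})
           \<longlonglongrightarrow> 0))"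
  unfolding has_quadratic_variation_def tendsto_in_prob_def sq_sum_def ..

locale cadlag_martingale = prob_space M for M :: "'a measure" +
  fixes F :: "real \<Rightarrow> 'a measure" and T :: real and X :: "real \<Rightarrow> 'a \<Rightarrow> real"
  assumes T_pos: "T > 0"
    and subalg: "t \<in> {0..T} \<Longrightarrow> subalgebra M (F t)"
    and filt: "\<lbrakk>0 \<le> s; s \<le> t; t \<le> T\<rbrakk> \<Longrightarrow> subalgebra (F t) (F s)"
    and adapted: "t \<in> {0..T} \<Longrightarrow> X t \<in> borel_measurable (F t)"
    and integ: "t \<in> {0..T} \<Longrightarrow> integrable M (X t)"
    and orth: "\<lbrakk>0 \<le> s; s \<le> t; t \<le> T; g \<in> borel_measurable (F s); \<And>\<omega>. \<bar>g \<omega>\<bar> \<le> K\<rbrakk>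
      \<Longrightarrow> (\<integral>\<omega>. g \<omega> * (X t \<omega> - X s \<omega>) \<partial>M) = 0"
    and cadlag: "AE \<omega> in M. cadlag_on T (\<lambda>t. X t \<omega>)"
begin

definition mean_abs :: real where "mean_abs = (\<integral>\<omega>. \<bar>X T \<omega>\<bar> \<partial>M)"

lemma mean_abs_nonneg: "mean_abs \<ge> 0"
  unfolding mean_abs_def by simp

lemma sampled:
  assumes r: "is_partition T n r"
  shows "finite_martingale M (\<lambda>j. F (r j)) (\<lambda>j. X (r j)) n"
proof
  fix j assume j: "j \<le> n"
  have "r j \<in> {0..T}" using is_partition_range[OF r j] .
  thus "subalgebra M (F (r j))" "X (r j) \<in> borel_measurable (F (r j))" "integrable M (X (r j))"
    using subalg adapted integ by auto
next
  fix j assume j: "j < n"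
  have *: "0 \<le> r j" "r j \<le> r (Suc j)" "r (Suc j) \<le> T"
    using is_partition_range[OF r, of j] is_partition_range[OF r, of "Suc j"] is_partition_mono[OF r, of j "Suc j"] j
    by auto
  show "subalgebra (F (r (Suc j))) (F (r j))" using filt[OF *] .
  fix g K assume "g \<in> borel_measurable (F (r j))" "\<And>\<omega>. \<bar>g \<omega>\<bar> \<le> (K::real)"
  thus "(\<integral>\<omega>. g \<omega> * (X (r (Suc j)) \<omega> - X (r j) \<omega>) \<partial>M) = 0" using orth[OF *] by blast
qed

lemma sq_sum_measurable:
  assumes "is_partition T N p"
  shows "(\<lambda>\<omega>. sq_sum (\<lambda>t. X t \<omega>) N p) \<in> borel_measurable M"
proof -
  interpret finite_martingale M "\<lambda>j. F (p j)" "\<lambda>j. X (p j)" N by (rule sampled[OF assms])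
  have "X (p i) \<in> borel_measurable M" if "i \<le> N" for i
    using borel_measurable_integrable[OF integ] that by auto
  thus ?thesis unfolding sq_sum_def by (intro borel_measurable_sum) auto
qed

lemma sq_sum_weak_type:
  assumes "is_partition T N p" "l > 0"
  shows "prob {\<omega> \<in> space M. sq_sum (\<lambda>t. X t \<omega>) N p \<ge> l} \<le> 2 / sqrt l * mean_abs"
proof -
  interpret finite_martingale M "\<lambda>j. F (p j)" "\<lambda>j. X (p j)" N by (rule sampled[OF assms(1)])
  have "p N = T" using assms(1) by (auto simp: is_partition_def)
  thus ?thesis using square_function_weak_type[OF assms(2)] by (simp add: sq_sum_def mean_abs_def)
qed

text \<open>\<open>R\<close> collects the part of the error that is small along every path; the rest is a
  martingale transform by \<open>X - hyst\<close>, which is bounded by \<open>\<epsilon>\<close>.\<close>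

lemma sq_sum_refinement_prob:
  assumes ref: "refinement T N p n r m" and "\<epsilon> > 0" "\<eta> > 0"
  defines "R \<equiv> \<lambda>\<omega>. \<Sum>j<n. (hyst \<epsilon> (m ` {..N}) (\<lambda>j. X (r j) \<omega>) j - block_start (m ` {..N}) (\<lambda>j. X (r j) \<omega>) j)
        * (X (r (Suc j)) \<omega> - X (r j) \<omega>)"
  shows "R \<in> borel_measurable M"
    and "prob {\<omega> \<in> space M. \<bar>sq_sum (\<lambda>t. X t \<omega>) n r - sq_sum (\<lambda>t. X t \<omega>) N p\<bar> > \<eta>} \<le>
      8 * \<epsilon> / \<eta> * mean_abs + prob {\<omega> \<in> space M. \<bar>R \<omega>\<bar> > \<eta> / 4}"
proof -
  have r: "is_partition T n r" using ref by (auto simp: refinement_def)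
  interpret finite_martingale M "\<lambda>j. F (r j)" "\<lambda>j. X (r j)" n by (rule sampled[OF r])
  define B where "B = m ` {..N}"
  define H where "H j \<omega> = hyst \<epsilon> B (\<lambda>j. X (r j) \<omega>) j" for j \<omega>
  define U where "U j \<omega> = X (r j) \<omega> - H j \<omega>" for j \<omega>
  define S where "S \<omega> = (\<Sum>j<n. U j \<omega> * (X (r (Suc j)) \<omega> - X (r j) \<omega>))" for \<omega>
  have XM[measurable]: "X (r i) \<in> borel_measurable M" if "i \<le> n" for i
    using borel_measurable_integrable[OF integ] that by auto
  have HF: "H j \<in> borel_measurable (F (r j))" if "j \<le> n" for j
    unfolding H_def using hyst_measurable[OF that] .
  have HM[measurable]: "H j \<in> borel_measurable M" if "j \<le> n" for j
    using measurable_from_subalg[OF subalg HF] that by auto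
  have UF: "U j \<in> borel_measurable (F (r j))" if "j \<le> n" for j
    unfolding U_def using HF adapted that by auto
  have BM: "(\<lambda>\<omega>. block_start B (\<lambda>j. X (r j) \<omega>) j) \<in> borel_measurable M" if "j \<le> n" for j
    using block_start_measurable[OF that] .
  show R[measurable]: "R \<in> borel_measurable M"
    unfolding R_def B_def[symmetric] H_def[symmetric] using XM HM BM by (intro borel_measurable_sum) auto
  have S[measurable]: "S \<in> borel_measurable M"
    unfolding S_def U_def using XM HM by (intro borel_measurable_sum) auto
  have rT: "r n = T" using r by (auto simp: is_partition_def)
  have weak: "prob {\<omega> \<in> space M. \<bar>S \<omega>\<bar> \<ge> \<eta> / 4} \<le> 2 * \<epsilon> / (\<eta> / 4) * (\<integral>\<omega>. \<bar>X (r n) \<omega>\<bar> \<partial>M)"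
    unfolding S_def
  proof (rule transform_weak_type)
    fix j \<omega> assume "j < n"
    show "\<bar>U j \<omega>\<bar> \<le> \<epsilon>" unfolding U_def H_def using hyst_close[of \<epsilon> "\<lambda>j. X (r j) \<omega>"] assms by auto
  qed (use UF assms in auto)
  have eq: "sq_sum (\<lambda>t. X t \<omega>) n r - sq_sum (\<lambda>t. X t \<omega>) N p = - 2 * (S \<omega> + R \<omega>)" for \<omega>
    unfolding sq_sum_refinement[OF ref] S_def R_def U_def H_def B_def sum.distrib[symmetric]
    by (simp add: algebra_simps)
  \<comment> \<open>If \<open>2 * \<bar>S + R\<bar> > \<eta>\<close>, then \<open>S\<close> or
    \<open>R\<close> exceeds \<open>\<eta> / 4\<close> in absolute value.\<close>
  have "prob {\<omega> \<in> space M. \<bar>sq_sum (\<lambda>t. X t \<omega>) n r - sq_sum (\<lambda>t. X t \<omega>) N p\<bar> > \<eta>} \<le>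
    prob ({\<omega> \<in> space M. \<bar>S \<omega>\<bar> \<ge> \<eta> / 4} \<union> {\<omega> \<in> space M. \<bar>R \<omega>\<bar> > \<eta> / 4})"
    unfolding eq by (rule finite_measure_mono) auto
  also have "\<dots> \<le> prob {\<omega> \<in> space M. \<bar>S \<omega>\<bar> \<ge> \<eta> / 4} + prob {\<omega> \<in> space M. \<bar>R \<omega>\<bar> > \<eta> / 4}"
    by (rule measure_Un_le) measurable
  finally show "prob {\<omega> \<in> space M. \<bar>sq_sum (\<lambda>t. X t \<omega>) n r - sq_sum (\<lambda>t. X t \<omega>) N p\<bar> > \<eta>} \<le>
      8 * \<epsilon> / \<eta> * mean_abs + prob {\<omega> \<in> space M. \<bar>R \<omega>\<bar> > \<eta> / 4}"
    using weak by (simp add: rT mean_abs_def algebra_simps)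
qed

text \<open>The mesh in \<open>hyst_error_small\<close> depends on the path. Arguing by
  contradiction leaves only a sequence of partitions with mesh tending to 0, and along it the
  pathwise error is eventually small almost surely, hence small in probability.\<close>

lemma sq_sum_refinement_close:
  assumes "\<eta> > 0"
  shows "\<exists>\<delta>>0. \<forall>N p n r m. refinement T N p n r m \<and> (\<forall>i<N. p (Suc i) - p i < \<delta>) \<longrightarrow>
    prob {\<omega> \<in> space M. \<bar>sq_sum (\<lambda>t. X t \<omega>) n r - sq_sum (\<lambda>t. X t \<omega>) N p\<bar> > \<eta>} \<le> \<eta>"
proof (rule ccontr)
  assume neg: "\<not> ?thesis"
  have "\<exists>N p n r m. refinement T N p n r m \<and> (\<forall>i<N. p (Suc i) - p i < 1 / Suc k) \<and>
    prob {\<omega> \<in> space M. \<bar>sq_sum (\<lambda>t. X t \<omega>) n r - sq_sum (\<lambda>t. X t \<omega>) N p\<bar> > \<eta>} > \<eta>" for k :: nat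
  proof (rule ccontr)
    assume "\<not> ?thesis"
    hence "\<forall>N p n r m. refinement T N p n r m \<and> (\<forall>i<N. p (Suc i) - p i < 1 / Suc k) \<longrightarrow>
      prob {\<omega> \<in> space M. \<bar>sq_sum (\<lambda>t. X t \<omega>) n r - sq_sum (\<lambda>t. X t \<omega>) N p\<bar> > \<eta>} \<le> \<eta>"
      by (meson not_less)
    moreover have "1 / real (Suc k) > 0" by simp
    ultimately show False using neg by blast
  qed
  hence "\<forall>k. \<exists>z. case z of (N, p, n, r, m) \<Rightarrow> refinement T N p n r m \<and>
    (\<forall>i<N. p (Suc i) - p i < 1 / Suc k) \<and>
    prob {\<omega> \<in> space M. \<bar>sq_sum (\<lambda>t. X t \<omega>) n r - sq_sum (\<lambda>t. X t \<omega>) N p\<bar> > \<eta>} > \<eta>" by simp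
  from choice[OF this] obtain z where z: "\<And>k. case z k of (N, p, n, r, m) \<Rightarrow> refinement T N p n r m \<and>
    (\<forall>i<N. p (Suc i) - p i < 1 / Suc k) \<and>
    prob {\<omega> \<in> space M. \<bar>sq_sum (\<lambda>t. X t \<omega>) n r - sq_sum (\<lambda>t. X t \<omega>) N p\<bar> > \<eta>} > \<eta>" by blast
  define N p n r m where "N k = fst (z k)" and "p k = fst (snd (z k))" and "n k = fst (snd (snd (z k)))"
    and "r k = fst (snd (snd (snd (z k))))" and "m k = snd (snd (snd (snd (z k))))" for k
  note z' = z[unfolded case_prod_beta, folded N_def p_def n_def r_def m_def]
  have ref: "refinement T (N k) (p k) (n k) (r k) (m k)"
    and mesh: "i < N k \<Longrightarrow> p k (Suc i) - p k i < 1 / Suc k"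
    and bad: "prob {\<omega> \<in> space M. \<bar>sq_sum (\<lambda>t. X t \<omega>) (n k) (r k) - sq_sum (\<lambda>t. X t \<omega>) (N k) (p k)\<bar> > \<eta>} > \<eta>" for i k
    using z'[of k] by blast+
  \<comment> \<open>Adding 1 permits division by \<open>a\<close>; \<open>\<epsilon>\<close> is then
    chosen so that the martingale part costs at most \<open>\<eta> / 2\<close>.\<close>
  define a where "a = mean_abs + 1"
  have a: "a > 0" "mean_abs \<le> a" using mean_abs_nonneg by (simp_all add: a_def)
  define \<epsilon> where "\<epsilon> = \<eta>\<^sup>2 / (16 * a)"
  have \<epsilon>: "\<epsilon> > 0" using assms a by (simp add: \<epsilon>_def)
  have "8 * \<epsilon> / \<eta> * mean_abs = \<eta> / 2 * (mean_abs / a)"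
    using assms a(1) by (simp add: \<epsilon>_def power2_eq_square field_simps)
  also have "\<dots> \<le> \<eta> / 2 * 1"
    using assms a by (intro mult_left_mono) auto
  finally have small: "8 * \<epsilon> / \<eta> * mean_abs \<le> \<eta> / 2" by simp
  define R where "R k \<omega> = (\<Sum>j<n k. (hyst \<epsilon> (m k ` {..N k}) (\<lambda>j. X (r k j) \<omega>) j
      - block_start (m k ` {..N k}) (\<lambda>j. X (r k j) \<omega>) j) * (X (r k (Suc j)) \<omega> - X (r k j) \<omega>))" for k \<omega>
  note est = sq_sum_refinement_prob[OF ref \<epsilon> assms, folded R_def]
  have "(\<lambda>k. prob {\<omega> \<in> space M. \<bar>R k \<omega>\<bar> > \<eta> / 4}) \<longlonglongrightarrow> 0"
  proof (rule prob_tendsto_0)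
    show "{\<omega> \<in> space M. \<bar>R k \<omega>\<bar> > \<eta> / 4} \<in> events" for k
      using est(1)[of k] by measurable
    show "AE \<omega> in M. \<forall>\<^sub>F k in sequentially. \<omega> \<notin> {\<omega> \<in> space M. \<bar>R k \<omega>\<bar> > \<eta> / 4}"
      using cadlag
    proof eventually_elim
      case (elim \<omega>)
      obtain \<delta> where \<delta>: "\<delta> > 0" "\<And>N p n r m. refinement T N p n r m \<Longrightarrow> (\<forall>i<N. p (Suc i) - p i < \<delta>) \<Longrightarrow>
        \<bar>\<Sum>j<n. (hyst \<epsilon> (m ` {..N}) (\<lambda>j. X (r j) \<omega>) j - block_start (m ` {..N}) (\<lambda>j. X (r j) \<omega>) j)
        * (X (r (Suc j)) \<omega> - X (r j) \<omega>)\<bar> \<le> \<eta> / 4"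
        using hyst_error_small[OF elim \<epsilon>, of "\<eta> / 4"] assms by auto
      have "\<forall>\<^sub>F k in sequentially. 1 / real (Suc k) < \<delta>"
        using LIMSEQ_inverse_real_of_nat \<delta>(1) by (auto simp: inverse_eq_divide intro: order_tendstoD)
      then show ?case
      proof eventually_elim
        case (elim k)
        have "\<forall>i<N k. p k (Suc i) - p k i < \<delta>" using mesh[of _ k] elim by force
        from \<delta>(2)[OF ref this] show ?case by (simp add: R_def)
      qed
    qed
  qed
  hence "\<forall>\<^sub>F k in sequentially. prob {\<omega> \<in> space M. \<bar>R k \<omega>\<bar> > \<eta> / 4} < \<eta> / 2"
    by (rule order_tendstoD(2)) (use assms in simp)
  then obtain k where "prob {\<omega> \<in> space M. \<bar>R k \<omega>\<bar> > \<eta> / 4} < \<eta> / 2"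
    by (auto simp: eventually_sequentially)
  with est(2)[of k] bad[of k] small show False by linarith
qed

text \<open>Both sums are compared with the sum along a common refinement.\<close>

lemma sq_sum_Cauchy:
  assumes "\<eta> > 0"
  shows "\<exists>\<delta>>0. \<forall>N p N' q. fine_partition T \<delta> N p \<longrightarrow> fine_partition T \<delta> N' q \<longrightarrow>
    prob {\<omega> \<in> space M. \<bar>sq_sum (\<lambda>t. X t \<omega>) N p - sq_sum (\<lambda>t. X t \<omega>) N' q\<bar> > \<eta>} \<le> \<eta>"
proof -
  obtain \<delta> where \<delta>: "\<delta> > 0" "\<forall>N p n r m. refinement T N p n r m \<and> (\<forall>i<N. p (Suc i) - p i < \<delta>) \<longrightarrow>
    prob {\<omega> \<in> space M. \<bar>sq_sum (\<lambda>t. X t \<omega>) n r - sq_sum (\<lambda>t. X t \<omega>) N p\<bar> > \<eta> / 2} \<le> \<eta> / 2"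
    using sq_sum_refinement_close[OF half_gt_zero[OF assms]] by blast
  have close: "prob {\<omega> \<in> space M. \<bar>sq_sum (\<lambda>t. X t \<omega>) n r - sq_sum (\<lambda>t. X t \<omega>) N p\<bar> > \<eta> / 2} \<le> \<eta> / 2"
    if "refinement T N p n r m" "fine_partition T \<delta> N p" for N p n r m
    using \<delta>(2) that unfolding fine_partition_def by blast
  show ?thesis
  proof (intro exI[of _ \<delta>] conjI allI impI)
    fix N p N' q
    assume fine: "fine_partition T \<delta> N p" "fine_partition T \<delta> N' q"
    hence p: "is_partition T N p" and q: "is_partition T N' q" by (auto simp: fine_partition_def)
    obtain n r m m' where ref: "refinement T N p n r m" "refinement T N' q n r m'"
      using common_refinement[OF p q] .
    have r: "is_partition T n r" using ref by (auto simp: refinement_def)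
    show "prob {\<omega> \<in> space M. \<bar>sq_sum (\<lambda>t. X t \<omega>) N p - sq_sum (\<lambda>t. X t \<omega>) N' q\<bar> > \<eta>} \<le> \<eta>"
      using prob_triangle[OF sq_sum_measurable[OF p] sq_sum_measurable[OF r] sq_sum_measurable[OF q], of "\<eta> / 2" "\<eta> / 2"]
        close[OF ref(1) fine(1)] close[OF ref(2) fine(2)]
      by (simp add: abs_minus_commute)
  qed (rule \<delta>(1))
qed

text \<open>Along one sequence of partitions the sums are Cauchy at a geometric rate, so by
  Borel-Cantelli they converge almost surely. The Cauchy property carries the limit over to all
  other sequences.\<close>

lemma has_quadratic_variation_exists: "\<exists>V. has_quadratic_variation M X T V"
proof -
  have "\<forall>j::nat. \<exists>\<delta>>0. \<forall>N p N' q. fine_partition T \<delta> N p \<longrightarrow> fine_partition T \<delta> N' q \<longrightarrow>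
    prob {\<omega> \<in> space M. \<bar>sq_sum (\<lambda>t. X t \<omega>) N p - sq_sum (\<lambda>t. X t \<omega>) N' q\<bar> > (1/2)^j} \<le> (1/2)^j"
    by (intro allI sq_sum_Cauchy) simp
  from choice[OF this] obtain d where d: "\<And>j::nat. d j > 0"
    "\<And>j N p N' q. fine_partition T (d j) N p \<Longrightarrow> fine_partition T (d j) N' q \<Longrightarrow>
    prob {\<omega> \<in> space M. \<bar>sq_sum (\<lambda>t. X t \<omega>) N p - sq_sum (\<lambda>t. X t \<omega>) N' q\<bar> > (1/2)^j} \<le> (1/2)^j"
    by blast
  \<comment> \<open>The minimum makes the partition number \<open>k\<close> fine enough for every
    \<open>d j\<close> with \<open>j \<le> k\<close>; the bound \<open>1 / Suc j\<close> sends the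
    mesh to 0.\<close>
  define e where "e j = Min (insert (1 / real (Suc j)) (d ` {..j}))" for j :: nat
  have e_pos: "e j > 0" for j using d(1) by (simp add: e_def)
  have e_le: "e j \<le> 1 / real (Suc j)" "i \<le> j \<Longrightarrow> e j \<le> d i" for i j
    unfolding e_def by (rule Min_le; simp)+
  obtain Na a where a: "\<And>j. fine_partition T (e j) (Na j) (a j)"
    using exists_fine_partition[OF T_pos e_pos] by metis
  define Y where "Y j \<omega> = sq_sum (\<lambda>t. X t \<omega>) (Na j) (a j)" for j \<omega>
  have Y[measurable]: "Y j \<in> borel_measurable M" for j
    unfolding Y_def using a by (intro sq_sum_measurable) (simp add: fine_partition_def)
  have mesh: "fine_partition T (d j) (Na k) (a k)" if "j \<le> k" for j k
    using fine_partition_mono[OF a e_le(2)[OF that]] .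
  \<comment> \<open>Where the sequence diverges, which is a null set, \<open>lim\<close> is an
    unspecified default; \<open>V\<close> is measurable all the same.\<close>
  define V where "V \<omega> = lim (\<lambda>j. Y j \<omega>)" for \<omega>
  have V[measurable]: "V \<in> borel_measurable M" unfolding V_def by measurable
  have "AE \<omega> in M. \<forall>\<^sub>F j in sequentially. \<omega> \<in> space M - {\<omega> \<in> space M. \<bar>Y j \<omega> - Y (Suc j) \<omega>\<bar> > (1/2)^j}"
  proof (rule borel_cantelli_AE1)
    show "summable (\<lambda>j. prob {\<omega> \<in> space M. \<bar>Y j \<omega> - Y (Suc j) \<omega>\<bar> > (1/2)^j})"
    proof (rule summable_comparison_test'[of "\<lambda>j. (1/2)^j" 0])
      fix j :: nat
      show "norm (prob {\<omega> \<in> space M. \<bar>Y j \<omega> - Y (Suc j) \<omega>\<bar> > (1/2)^j}) \<le> (1/2)^j"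
        using d(2)[OF mesh[of j j] mesh[of j "Suc j"]] by (simp add: Y_def)
    qed (simp add: summable_geometric)
  qed (auto simp: less_top[symmetric])
  hence YV: "AE \<omega> in M. (\<lambda>j. Y j \<omega>) \<longlonglongrightarrow> V \<omega>"
  proof eventually_elim
    case (elim \<omega>)
    have "convergent (\<lambda>j. Y j \<omega>)"
      by (rule convergent_if_geometric_increments) (use elim in \<open>auto elim!: eventually_mono simp: not_less\<close>)
    then show ?case by (simp add: V_def convergent_LIMSEQ_iff)
  qed
  have Yprob: "(\<lambda>j. prob {\<omega> \<in> space M. \<bar>Y j \<omega> - V \<omega>\<bar> > \<epsilon>}) \<longlonglongrightarrow> 0" if "\<epsilon> > 0" for \<epsilon>
  proof (rule prob_tendsto_0)
    show "AE \<omega> in M. \<forall>\<^sub>F k in sequentially. \<omega> \<notin> {\<omega> \<in> space M. \<bar>Y k \<omega> - V \<omega>\<bar> > \<epsilon>}"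
      using YV
    proof eventually_elim
      case (elim \<omega>)
      from tendstoD[OF this that] show ?case by eventually_elim (auto simp: dist_real_def)
    qed
  qed measurable
  have "has_quadratic_variation M X T V"
    unfolding has_quadratic_variation_iff
  proof (intro conjI V allI impI; (elim conjE)?)
    fix N p and \<epsilon> :: real
    assume "\<epsilon> > 0" and p: "\<forall>k. is_partition T (N k) (p k)"
      and fine: "\<forall>\<delta>>0. \<forall>\<^sub>F k in sequentially. \<forall>i<N k. p k (Suc i) - p k i < \<delta>"
    show "(\<lambda>k. prob {\<omega> \<in> space M. \<bar>sq_sum (\<lambda>t. X t \<omega>) (N k) (p k) - V \<omega>\<bar> > \<epsilon>}) \<longlonglongrightarrow> 0"
    proof (rule LIMSEQ_I)
      fix \<rho> :: real assume "\<rho> > 0"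
      \<comment> \<open>\<open>\<eta>\<close> is both the threshold and the probability in
        \<open>sq_sum_Cauchy\<close>, so it must lie below both halves.\<close>
      define \<eta> where "\<eta> = min (\<epsilon> / 2) (\<rho> / 2)"
      have \<eta>: "\<eta> > 0" "\<eta> \<le> \<epsilon> / 2" "\<eta> \<le> \<rho> / 2" using \<open>\<epsilon> > 0\<close> \<open>\<rho> > 0\<close> by (auto simp: \<eta>_def)
      obtain \<delta> where \<delta>: "\<delta> > 0"
        "\<And>N p N' q. fine_partition T \<delta> N p \<Longrightarrow> fine_partition T \<delta> N' q \<Longrightarrow>
        prob {\<omega> \<in> space M. \<bar>sq_sum (\<lambda>t. X t \<omega>) N p - sq_sum (\<lambda>t. X t \<omega>) N' q\<bar> > \<eta>} \<le> \<eta>"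
        using sq_sum_Cauchy[OF \<eta>(1)] by blast
      have "\<forall>\<^sub>F j in sequentially. 1 / real (Suc j) < \<delta>"
        using LIMSEQ_inverse_real_of_nat \<delta>(1) by (auto simp: inverse_eq_divide intro: order_tendstoD)
      moreover have "\<forall>\<^sub>F j in sequentially. prob {\<omega> \<in> space M. \<bar>Y j \<omega> - V \<omega>\<bar> > \<epsilon> / 2} < \<rho> / 2"
        by (rule order_tendstoD(2)[OF Yprob]) (use \<open>\<epsilon> > 0\<close> \<open>\<rho> > 0\<close> in simp_all)
      ultimately have "\<forall>\<^sub>F j in sequentially. 1 / real (Suc j) < \<delta> \<and> prob {\<omega> \<in> space M. \<bar>Y j \<omega> - V \<omega>\<bar> > \<epsilon> / 2} < \<rho> / 2"
        by (rule eventually_conj)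
      then obtain j where j: "1 / real (Suc j) < \<delta>" "prob {\<omega> \<in> space M. \<bar>Y j \<omega> - V \<omega>\<bar> > \<epsilon> / 2} < \<rho> / 2"
        by (auto simp: eventually_sequentially)
      have aj: "fine_partition T \<delta> (Na j) (a j)"
        by (rule fine_partition_mono[OF a]) (use e_le(1)[of j] j(1) in linarith)
      have "\<forall>\<^sub>F k in sequentially. \<forall>i<N k. p k (Suc i) - p k i < \<delta>" using fine \<delta>(1) by blast
      then obtain k0 where k0: "\<And>k. k \<ge> k0 \<Longrightarrow> fine_partition T \<delta> (N k) (p k)"
        using p unfolding eventually_sequentially fine_partition_def by blast
      have "prob {\<omega> \<in> space M. \<bar>sq_sum (\<lambda>t. X t \<omega>) (N k) (p k) - V \<omega>\<bar> > \<epsilon>} < \<rho>" if k: "k \<ge> k0" for k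
      proof -
        have pk: "is_partition T (N k) (p k)" using p by blast
        note [measurable] = sq_sum_measurable[OF pk]
        have "prob {\<omega> \<in> space M. \<bar>sq_sum (\<lambda>t. X t \<omega>) (N k) (p k) - V \<omega>\<bar> > \<epsilon> / 2 + \<epsilon> / 2} \<le>
          prob {\<omega> \<in> space M. \<bar>sq_sum (\<lambda>t. X t \<omega>) (N k) (p k) - Y j \<omega>\<bar> > \<epsilon> / 2} +
          prob {\<omega> \<in> space M. \<bar>Y j \<omega> - V \<omega>\<bar> > \<epsilon> / 2}"
          by (rule prob_triangle) measurable
        moreover have "prob {\<omega> \<in> space M. \<bar>sq_sum (\<lambda>t. X t \<omega>) (N k) (p k) - Y j \<omega>\<bar> > \<epsilon> / 2} \<le>
          prob {\<omega> \<in> space M. \<bar>sq_sum (\<lambda>t. X t \<omega>) (N k) (p k) - Y j \<omega>\<bar> > \<eta>}"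
          using \<eta>(2) by (intro finite_measure_mono) auto
        moreover have "prob {\<omega> \<in> space M. \<bar>sq_sum (\<lambda>t. X t \<omega>) (N k) (p k) - Y j \<omega>\<bar> > \<eta>} \<le> \<eta>"
          unfolding Y_def by (rule \<delta>(2)[OF k0[OF k] aj])
        ultimately show ?thesis using \<eta>(3) j(2) by simp
      qed
      thus "\<exists>k0. \<forall>k\<ge>k0. norm (prob {\<omega> \<in> space M. \<bar>sq_sum (\<lambda>t. X t \<omega>) (N k) (p k) - V \<omega>\<bar> > \<epsilon>} - 0) < \<rho>"
        by (intro exI[of _ k0]) auto
    qed
  qed
  thus ?thesis by blast
qed

text \<open>The weak type bound for the sums does not depend on the partition, so it survives the
  limit in probability, at the cost of halving \<open>l\<close>.\<close>

lemma quadratic_variation_weak_type: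
  assumes "l > 0"
  shows "prob {\<omega> \<in> space M. \<bar>quadratic_variation M X T \<omega>\<bar> > l} \<le> 2 / sqrt (l / 2) * mean_abs"
proof -
  define V where "V = quadratic_variation M X T"
  have qv: "has_quadratic_variation M X T V"
    unfolding V_def quadratic_variation_def using someI_ex[OF has_quadratic_variation_exists] .
  have "\<exists>N p. fine_partition T (1 / real (Suc k)) N p" for k
    by (rule exists_fine_partition[OF T_pos]) simp
  then obtain N p where "\<And>k. fine_partition T (1 / real (Suc k)) (N k) (p k)" by metis
  hence p: "\<And>k. is_partition T (N k) (p k)" "\<And>k. \<forall>i<N k. p k (Suc i) - p k i < 1 / real (Suc k)"
    by (simp_all add: fine_partition_def)
  have fine: "\<forall>\<^sub>F k in sequentially. \<forall>i<N k. p k (Suc i) - p k i < \<delta>" if "\<delta> > 0" for \<delta>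
  proof -
    have "\<forall>\<^sub>F k in sequentially. 1 / real (Suc k) < \<delta>"
      using LIMSEQ_inverse_real_of_nat that by (auto simp: inverse_eq_divide intro: order_tendstoD)
    thus ?thesis by eventually_elim (use p(2) in force)
  qed
  have V[measurable]: "V \<in> borel_measurable M"
    and lim: "(\<lambda>k. prob {\<omega> \<in> space M. \<bar>sq_sum (\<lambda>t. X t \<omega>) (N k) (p k) - V \<omega>\<bar> > l / 2}) \<longlonglongrightarrow> 0"
    using qv p(1) fine half_gt_zero[OF assms] unfolding has_quadratic_variation_iff by blast+
  have "prob {\<omega> \<in> space M. \<bar>V \<omega>\<bar> > l} \<le> 2 / sqrt (l / 2) * mean_abs +
     prob {\<omega> \<in> space M. \<bar>sq_sum (\<lambda>t. X t \<omega>) (N k) (p k) - V \<omega>\<bar> > l / 2}" for k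
  proof -
    note [measurable] = sq_sum_measurable[OF p(1)]
    have nn: "sq_sum (\<lambda>t. X t \<omega>) (N k) (p k) \<ge> 0" for \<omega> by (auto simp: sq_sum_def intro!: sum_nonneg)
    \<comment> \<open>\<open>V\<close> is an arbitrary version and may be negative; then
      nonnegativity of the sums puts it far from them.\<close>
    have "l / 2 \<le> sq_sum (\<lambda>t. X t \<omega>) (N k) (p k) \<or> \<bar>sq_sum (\<lambda>t. X t \<omega>) (N k) (p k) - V \<omega>\<bar> > l / 2"
      if "\<bar>V \<omega>\<bar> > l" for \<omega> using that nn[of \<omega>] by linarith
    hence "prob {\<omega> \<in> space M. \<bar>V \<omega>\<bar> > l} \<le>
      prob ({\<omega> \<in> space M. l / 2 \<le> sq_sum (\<lambda>t. X t \<omega>) (N k) (p k)} \<union>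
        {\<omega> \<in> space M. \<bar>sq_sum (\<lambda>t. X t \<omega>) (N k) (p k) - V \<omega>\<bar> > l / 2})"
      by (intro finite_measure_mono) auto
    also have "\<dots> \<le> prob {\<omega> \<in> space M. l / 2 \<le> sq_sum (\<lambda>t. X t \<omega>) (N k) (p k)} +
        prob {\<omega> \<in> space M. \<bar>sq_sum (\<lambda>t. X t \<omega>) (N k) (p k) - V \<omega>\<bar> > l / 2}"
      by (rule measure_Un_le) measurable
    finally show ?thesis using sq_sum_weak_type[OF p(1)[of k], of "l / 2"] assms by simp
  qed
  hence "prob {\<omega> \<in> space M. \<bar>V \<omega>\<bar> > l} \<le> 2 / sqrt (l / 2) * mean_abs + 0"
    by (intro LIMSEQ_le_const[OF tendsto_add[OF tendsto_const lim]]) auto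
  thus ?thesis by (simp add: V_def)
qed

end

section \<open>Density processes\<close>

lemma augmented_filtration_generators:
  fixes L :: "real \<Rightarrow> 'a \<Rightarrow> 'b::topological_space"
  shows "{L s -` A \<inter> space M | s A. 0 \<le> s \<and> s \<le> t \<and> A \<in> sets borel} \<union> null_sets M \<subseteq> Pow (space M)"
proof (rule Un_least)
  show "null_sets M \<subseteq> Pow (space M)"
    by (rule subsetI, rule PowI, rule sets.sets_into_space, rule null_setsD2)
  show "{L s -` A \<inter> space M | s A. 0 \<le> s \<and> s \<le> t \<and> A \<in> sets borel} \<subseteq> Pow (space M)"
    by auto
qed

lemma space_augmented_filtration: "space (augmented_filtration M L t) = space M"
  unfolding augmented_filtration_def by (rule space_measure_of[OF augmented_filtration_generators])

lemma subalgebra_augmented_filtration: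
  assumes "s \<le> t"
  shows "subalgebra (augmented_filtration M L t) (augmented_filtration M L s)"
proof -
  have "{L s' -` A \<inter> space M | s' A. 0 \<le> s' \<and> s' \<le> s \<and> A \<in> sets borel} \<union> null_sets M
      \<subseteq> {L s' -` A \<inter> space M | s' A. 0 \<le> s' \<and> s' \<le> t \<and> A \<in> sets borel} \<union> null_sets M"
    using order.trans[OF _ assms] by (intro Un_mono Collect_mono subset_refl) metis
  hence "sets (augmented_filtration M L s) \<subseteq> sets (augmented_filtration M L t)"
    unfolding augmented_filtration_def sets_measure_of[OF augmented_filtration_generators]
    by (rule sigma_sets_mono')
  thus ?thesis by (simp add: subalgebra_def space_augmented_filtration)
qed

lemma (in prob_space) integrable_prob_density:
  assumes "Q \<in> ac_prob_measures M"
  shows "integrable M (prob_density M Q)"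
proof (rule integrableI_bounded)
  show "prob_density M Q \<in> borel_measurable M" unfolding prob_density_def by measurable
  have Q: "prob_space Q" "sets Q = sets M" "absolutely_continuous M Q"
    using assms by (auto simp: ac_prob_measures_def)
  have "(\<integral>\<^sup>+\<omega>. norm (prob_density M Q \<omega>) \<partial>M) \<le> (\<integral>\<^sup>+\<omega>. RN_deriv M Q \<omega> * 1 \<partial>M)"
    \<comment> \<open>\<open>enn2real\<close> sends infinity to 0, so only an inequality is
      claimed.\<close>
    by (intro nn_integral_mono) (simp add: prob_density_def ennreal_enn2real_if)
  also have "\<dots> = (\<integral>\<^sup>+\<omega>. 1 \<partial>Q)"
    using Q by (intro RN_deriv_nn_integral[symmetric]) auto
  also have "\<dots> = 1" using prob_space.emeasure_space_1[OF Q(1)] by simp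
  finally show "(\<integral>\<^sup>+\<omega>. norm (prob_density M Q \<omega>) \<partial>M) < \<infinity>" by (simp add: le_less_trans)
qed

text \<open>\<open>D t\<close> is a version of the conditional expectation of the terminal density.
  The right side of the second claim does not involve \<open>t\<close>, which yields the martingale
  property; in the third, conditioning on all events changes nothing.\<close>

lemma (in prob_space) density_process_cond_exp:
  assumes D: "density_process M F T Q D" and Q: "Q \<in> ac_prob_measures M"
    and sub: "subalgebra M (F t)" and t: "t \<in> {0..T}"
  shows "integrable M (D t)"
    and "\<lbrakk>g \<in> borel_measurable (F t); \<And>\<omega>. \<bar>g \<omega>\<bar> \<le> K\<rbrakk> \<Longrightarrow>
      (\<integral>\<omega>. g \<omega> * D t \<omega> \<partial>M) = (\<integral>\<omega>. g \<omega> * prob_density M Q \<omega> \<partial>M)"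
    and "sets (F t) = sets M \<Longrightarrow> AE \<omega> in M. D t \<omega> = prob_density M Q \<omega>"
proof -
  interpret finite_measure_subalgebra M "F t" by unfold_locales (rule sub)
  note Z = integrable_prob_density[OF Q]
  have DF: "D t \<in> borel_measurable (F t)"
    and DE: "AE \<omega> in M. D t \<omega> = real_cond_exp M (F t) (prob_density M Q) \<omega>"
    using D t by (auto simp: density_process_def)
  have DM[measurable]: "D t \<in> borel_measurable M" by (rule measurable_from_subalg[OF sub DF])
  show "integrable M (D t)"
    using real_cond_exp_int(1)[OF Z] DE by (subst integrable_cong_AE[OF _ _ DE]) auto
  show "AE \<omega> in M. D t \<omega> = prob_density M Q \<omega>" if "sets (F t) = sets M"
  proof -
    have "prob_density M Q \<in> borel_measurable (F t)"
      using borel_measurable_integrable[OF Z] that by (simp cong: measurable_cong_sets)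
    from real_cond_exp_F_meas[OF Z this] DE show ?thesis by eventually_elim simp
  qed
  assume g: "g \<in> borel_measurable (F t)" "\<And>\<omega>. \<bar>g \<omega>\<bar> \<le> K"
  have gM[measurable]: "g \<in> borel_measurable M" by (rule measurable_from_subalg[OF sub g(1)])
  have ZM[measurable]: "prob_density M Q \<in> borel_measurable M" using Z by simp
  have "integrable M (\<lambda>\<omega>. g \<omega> * prob_density M Q \<omega>)"
    by (rule Bochner_Integration.integrable_bound[of M "\<lambda>\<omega>. K * prob_density M Q \<omega>"])
      (use Z g(2) in \<open>auto simp: abs_mult intro!: mult_right_mono AE_I2 intro: order.trans[OF _ abs_ge_self]\<close>)
  from real_cond_exp_intg(2)[OF this g(1)]
  have "(\<integral>\<omega>. g \<omega> * real_cond_exp M (F t) (prob_density M Q) \<omega> \<partial>M) = (\<integral>\<omega>. g \<omega> * prob_density M Q \<omega> \<partial>M)"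
    by simp
  moreover have "(\<integral>\<omega>. g \<omega> * D t \<omega> \<partial>M) = (\<integral>\<omega>. g \<omega> * real_cond_exp M (F t) (prob_density M Q) \<omega> \<partial>M)"
    by (rule integral_cong_AE) (use DE in auto)
  ultimately show "(\<integral>\<omega>. g \<omega> * D t \<omega> \<partial>M) = (\<integral>\<omega>. g \<omega> * prob_density M Q \<omega> \<partial>M)" by simp
qed

lemma cadlag_on_diff:
  fixes f g :: "real \<Rightarrow> real"
  assumes "cadlag_on T f" "cadlag_on T g" shows "cadlag_on T (\<lambda>t. f t - g t)"
  using assms unfolding cadlag_on_def by (fast intro: tendsto_diff)

text \<open>A bounded multiplier measurable at time \<open>s\<close> has the same mean against the
  process at \<open>s\<close> and at \<open>t\<close>, namely that against the terminal
  density.\<close>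

lemma (in prob_space) cadlag_martingale_density_diff:
  assumes "T > 0" and sets: "sets M = sets (augmented_filtration M L T)"
    and Q: "Q1 \<in> ac_prob_measures M" "Q2 \<in> ac_prob_measures M"
    and D: "density_process M (augmented_filtration M L) T Q1 D1"
      "density_process M (augmented_filtration M L) T Q2 D2"
  shows "cadlag_martingale M (augmented_filtration M L) T (\<lambda>t \<omega>. D1 t \<omega> - D2 t \<omega>)"
proof -
  let ?F = "augmented_filtration M L"
  have sub: "subalgebra M (?F t)" if "t \<in> {0..T}" for t
    using subalgebra_augmented_filtration[of t T M L] that sets
    by (auto simp: subalgebra_def space_augmented_filtration)
  note dp = density_process_cond_exp[OF D(1) Q(1) sub] density_process_cond_exp[OF D(2) Q(2) sub]
  show ?thesis
  proof
    show "T > 0" by fact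
    show "AE \<omega> in M. cadlag_on T (\<lambda>t. D1 t \<omega> - D2 t \<omega>)"
      using D unfolding density_process_def by (auto intro: cadlag_on_diff)
    fix t assume t: "t \<in> {0..T}"
    show "subalgebra M (?F t)" by (rule sub[OF t])
    show "(\<lambda>\<omega>. D1 t \<omega> - D2 t \<omega>) \<in> borel_measurable (?F t)"
      using D t unfolding density_process_def by (intro borel_measurable_diff) blast+
    show "integrable M (\<lambda>\<omega>. D1 t \<omega> - D2 t \<omega>)" using dp(1,4)[OF t t] by auto
  next
    fix s t :: real assume st: "0 \<le> s" "s \<le> t" "t \<le> T"
    show F: "subalgebra (?F t) (?F s)" by (rule subalgebra_augmented_filtration) fact
    fix g K assume g: "g \<in> borel_measurable (?F s)" "\<And>\<omega>. \<bar>g \<omega>\<bar> \<le> (K::real)"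
    have s: "s \<in> {0..T}" and t: "t \<in> {0..T}" using st by auto
    have gt: "g \<in> borel_measurable (?F t)" by (rule measurable_from_subalg[OF F g(1)])
    have gM: "g \<in> borel_measurable M" by (rule measurable_from_subalg[OF sub[OF s] g(1)])
    have int: "integrable M (\<lambda>\<omega>. g \<omega> * f \<omega>)" if "integrable M f" for f :: "'a \<Rightarrow> real"
      by (rule Bochner_Integration.integrable_bound[of M "\<lambda>\<omega>. K * f \<omega>"])
        (use that gM g(2) in \<open>auto simp: abs_mult intro!: mult_right_mono AE_I2 intro: order.trans[OF _ abs_ge_self]\<close>)
    note ints = int[OF dp(1)[OF s s]] int[OF dp(1)[OF t t]] int[OF dp(4)[OF s s]] int[OF dp(4)[OF t t]]
    have "(\<integral>\<omega>. g \<omega> * ((D1 t \<omega> - D2 t \<omega>) - (D1 s \<omega> - D2 s \<omega>)) \<partial>M) =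
      ((\<integral>\<omega>. g \<omega> * D1 t \<omega> \<partial>M) - (\<integral>\<omega>. g \<omega> * D2 t \<omega> \<partial>M)) - ((\<integral>\<omega>. g \<omega> * D1 s \<omega> \<partial>M) - (\<integral>\<omega>. g \<omega> * D2 s \<omega> \<partial>M))"
      using ints by (simp add: right_diff_distrib)
    also have "\<dots> = 0"
      using dp(2)[OF t t gt g(2)] dp(2)[OF s s g] dp(5)[OF t t gt g(2)] dp(5)[OF s s g] by simp
    finally show "(\<integral>\<omega>. g \<omega> * ((D1 t \<omega> - D2 t \<omega>) - (D1 s \<omega> - D2 s \<omega>)) \<partial>M) = 0" .
  qed
qed

theorem proposition3p1:
  fixes P :: "'a measure"
    and T :: real
    and L :: "real \<Rightarrow> 'a \<Rightarrow> 'b::euclidean_space"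
    and Qn :: "nat \<Rightarrow> 'a measure" and Q :: "'a measure"
    and Dn :: "nat \<Rightarrow> real \<Rightarrow> 'a \<Rightarrow> real" and D :: "real \<Rightarrow> 'a \<Rightarrow> real"
  assumes "prob_space P"
    and "T > 0"
    and "levy_process_on P T L"
    and "sets P = sets (augmented_filtration P L T)"
    and "\<And>n. Qn n \<in> ac_prob_measures P"
    and "Q \<in> ac_prob_measures P"
    and "(\<lambda>n. \<integral>\<omega>. \<bar>prob_density P (Qn n) \<omega> - prob_density P Q \<omega>\<bar> \<partial>P) \<longlonglongrightarrow> 0"
    and "\<And>n. density_process P (augmented_filtration P L) T (Qn n) (Dn n)"
    and "density_process P (augmented_filtration P L) T Q D"
  shows "tendsto_in_prob P (\<lambda>n. quadratic_variation P (\<lambda>t \<omega>. Dn n t \<omega> - D t \<omega>) T) (\<lambda>_. 0)"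
  unfolding tendsto_in_prob_def
proof (intro allI impI)
  fix l :: real assume l: "l > 0"
  interpret prob_space P by fact
  have sub: "subalgebra P (augmented_filtration P L T)"
    using assms(4) by (auto simp: subalgebra_def space_augmented_filtration)
  have T: "T \<in> {0..T}" using assms(2) by auto
  \<comment> \<open>At time \<open>T\<close> the filtration exhausts all events, so the difference
    process ends almost surely in the difference of the densities and \<open>mean_abs\<close> is
    their distance in \<open>L\<^sup>1\<close>.\<close>
  have bound: "prob {\<omega> \<in> space P. \<bar>quadratic_variation P (\<lambda>t \<omega>. Dn n t \<omega> - D t \<omega>) T \<omega> - 0\<bar> > l}
    \<le> 2 / sqrt (l / 2) * (\<integral>\<omega>. \<bar>prob_density P (Qn n) \<omega> - prob_density P Q \<omega>\<bar> \<partial>P)" for n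
  proof -
    interpret X: cadlag_martingale P "augmented_filtration P L" T "\<lambda>t \<omega>. Dn n t \<omega> - D t \<omega>"
      by (rule cadlag_martingale_density_diff) fact+
    have AE1: "AE \<omega> in P. Dn n T \<omega> = prob_density P (Qn n) \<omega>"
      by (rule density_process_cond_exp(3)[OF assms(8) assms(5) sub T assms(4)[symmetric]])
    have AE2: "AE \<omega> in P. D T \<omega> = prob_density P Q \<omega>"
      by (rule density_process_cond_exp(3)[OF assms(9) assms(6) sub T assms(4)[symmetric]])
    have "X.mean_abs = (\<integral>\<omega>. \<bar>prob_density P (Qn n) \<omega> - prob_density P Q \<omega>\<bar> \<partial>P)"
      unfolding X.mean_abs_def
    proof (rule integral_cong_AE)
      show "AE \<omega> in P. \<bar>Dn n T \<omega> - D T \<omega>\<bar> = \<bar>prob_density P (Qn n) \<omega> - prob_density P Q \<omega>\<bar>"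
        using AE1 AE2 by eventually_elim simp
    qed (use X.integ[OF T] integrable_prob_density[OF assms(5)[of n]] integrable_prob_density[OF assms(6)] in auto)
    thus ?thesis using X.quadratic_variation_weak_type[OF l] by simp
  qed
  show "(\<lambda>n. prob {\<omega> \<in> space P. \<bar>quadratic_variation P (\<lambda>t \<omega>. Dn n t \<omega> - D t \<omega>) T \<omega> - 0\<bar> > l}) \<longlonglongrightarrow> 0"
    by (rule tendsto_sandwich[OF _ _ tendsto_const tendsto_mult_right_zero[OF assms(7), of "2 / sqrt (l / 2)"]])
      (use bound in \<open>simp_all add: always_eventually\<close>)
qed

end
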